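(* Let $f \in \mathbb{Z}[X_1, X_2, Y_1, Y_2]$ be a bihomogeneous polynomial of bidegree $(d_1, d_2)$ with $d_1, d_2 \ge 1$, irreducible over $\mathbb{Q}$. Then for all $B_1 \ge 1$ and $B_2 \ge 2$, \[ N_{\mathbb{P}^1 \times \mathbb{P}^1}(f, B_1, B_2) \ll d_1^7 d_2^4 B_1^{2/d_2} (\log B_2)^2, \] with an absolute implied constant.
   Context: A polynomial in $\mathbb{Z}[X_1,X_2,Y_1,Y_2]$ is bihomogeneous of bidegree $(d_1,d_2)$ if it is homogeneous of degree $d_1$ in $(X_1,X_2)$ and homogeneous of degree $d_2$ in $(Y_1,Y_2)$. For a point $(x_1:x_2)\in\mathbb{P}^1(\mathbb{Q})$ with coprime integer coordinates, $H(x_1:x_2)=\max(|x_1|,|x_2|)$. $N_{\mathbb{P}^1\times\mathbb{P}^1}(f,B_1,B_2)$ is the number of $((x_1:x_2),(y_1:y_2))\in\mathbb{P}^1(\mathbb{Q})\times\mathbb{P}^1(\mathbb{Q})$ with $f(x_1,x_2,y_1,y_2)=0$, $H(x_1:x_2)\le B_1$ and $H(y_1:y_2)\le B_2$. *)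

theory Defs
  imports Complex_Main "HOL-Computational_Algebra.Polynomial"
begin

text \<open>A polynomial in Z[X1,X2,Y1,Y2] is represented as a nested univariate polynomial
  of type int poly poly poly poly: the innermost variable is X1, then X2, then Y1,
  and the outermost variable is Y2.  The coefficient of X1^i X2^j Y1^k Y2^l is
  coeff4 f i j k l.\<close>

type_synonym 'a mpoly4 = "'a poly poly poly poly"

definition coeff4 :: "'a::zero mpoly4 \<Rightarrow> nat \<Rightarrow> nat \<Rightarrow> nat \<Rightarrow> nat \<Rightarrow> 'a" where
  "coeff4 f i j k l = coeff (coeff (coeff (coeff f l) k) j) i"

definition eval4 :: "'a::comm_semiring_1 mpoly4 \<Rightarrow> 'a \<Rightarrow> 'a \<Rightarrow> 'a \<Rightarrow> 'a \<Rightarrow> 'a" where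
  "eval4 f x1 x2 y1 y2 =
     poly (map_poly (\<lambda>q. poly (map_poly (\<lambda>r. poly (map_poly (\<lambda>s. poly s x1) r) x2) q) y1) f) y2"

definition bihomogeneous :: "'a::zero mpoly4 \<Rightarrow> nat \<Rightarrow> nat \<Rightarrow> bool" where
  "bihomogeneous f d1 d2 \<longleftrightarrow>
     (\<forall>i j k l. coeff4 f i j k l \<noteq> 0 \<longrightarrow> i + j = d1 \<and> k + l = d2)"

definition to_rat4 :: "int mpoly4 \<Rightarrow> rat mpoly4" where
  "to_rat4 f = map_poly (map_poly (map_poly (map_poly rat_of_int))) f"

text \<open>Canonical representatives of P^1(Q): coprime integer pairs (x1,x2), normalised
  by x1 > 0, or (x1,x2) = (0,1).  Each point of P^1(Q) has exactly one such representative.\<close>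
definition P1_rep :: "int \<times> int \<Rightarrow> bool" where
  "P1_rep p \<longleftrightarrow> coprime (fst p) (snd p) \<and> (fst p > 0 \<or> (fst p = 0 \<and> snd p = 1))"

definition height1 :: "int \<times> int \<Rightarrow> int" where
  "height1 p = max \<bar>fst p\<bar> \<bar>snd p\<bar>"

definition N_P1P1 :: "int mpoly4 \<Rightarrow> real \<Rightarrow> real \<Rightarrow> nat" where
  "N_P1P1 f B1 B2 = card {(x, y). P1_rep x \<and> P1_rep y \<and>
      eval4 f (fst x) (snd x) (fst y) (snd y) = 0 \<and>
      real_of_int (height1 x) \<le> B1 \<and> real_of_int (height1 y) \<le> B2}"

end

theory Submission
  imports Defs "Jordan_Normal_Form.Determinant" "HOL-Computational_Algebra.Field_as_Ring"
    "HOL-Number_Theory.Cong" "HOL-Library.FuncSet" "HOL-Library.Discrete_Functions"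
    "HOL-Real_Asymp.Real_Asymp"
begin

text \<open>
  The proof is a determinant method in which Siegel's pigeonhole argument replaces determinants.
  In affine coordinates \<open>(t, u) = (x\<^sub>2 / x\<^sub>1, y\<^sub>2 / y\<^sub>1)\<close> the curve is \<open>F(t, u) = 0\<close> with
  \<open>F\<close> of degree \<open>d\<^sub>2\<close> in \<open>u\<close>. Fix a prime power \<open>q\<close> of size about \<open>B\<^sub>1 powr (2 / d\<^sub>2)\<close>. The points
  reducing to a given simple point lie on a curve \<open>u = h(t)\<close> modulo a high power of \<open>q\<close>, by Hensel's
  lemma, and the pigeonhole principle yields a form of bidegree \<open>(M, d\<^sub>2 - 1)\<close> with
  \<open>M\<close> about \<open>ln B\<^sub>2\<close>, of small height, which is divisible by that power at all of them and hence vanishes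
  there. Its degree in \<open>u\<close> is too small for it to be a multiple of \<open>F\<close>, so the resultant with \<open>F\<close> bounds the number of
  points in the class by a multiple of \<open>ln B\<^sub>2\<close>.

  Hensel's lemma is applied not to \<open>F\<close> but to a multiple \<open>\<Gamma>\<close> of \<open>F\<close> of small height, so that the
  coefficients of \<open>F\<close> play no role. The integers \<open>x\<^sub>1 y\<^sub>1 \<partial>\<Gamma>/\<partial>u\<close> at the points have logarithms
  \<open>O(d\<^sub>1 d\<^sub>2 ln B\<^sub>2)\<close>, so by Chebyshev's bound some prime \<open>l\<close> of at most that size is coprime to at least half of
  them. Taking \<open>q\<close> to be a power of \<open>l\<close> costs a factor \<open>l\<close>, which is the second logarithm of the theorem.
\<close>

hide_const (open) module.smult

section \<open>Bihomogeneous forms and their dehomogenisation\<close>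


text \<open>For \<open>degree p <= e\<close> this is \<open>a ^ e * p(b / a)\<close> written without
  division. The formal degree \<open>e\<close> may exceed the true one, and \<open>a = 0\<close> is
  the point at infinity.\<close>

definition hpoly :: "nat \<Rightarrow> 'a::comm_ring_1 poly \<Rightarrow> 'a \<Rightarrow> 'a \<Rightarrow> 'a" where
  "hpoly e p a b = (\<Sum>i\<le>e. coeff p i * a ^ (e - i) * b ^ i)"

text \<open>Throughout, the inner variable is \<open>t = x2 / x1\<close> and the outer one
  \<open>u = y2 / y1\<close>.\<close>

definition bideg_le :: "nat \<Rightarrow> nat \<Rightarrow> 'a::zero poly poly \<Rightarrow> bool" where
  "bideg_le e1 e2 G \<longleftrightarrow> degree G \<le> e2 \<and> (\<forall>l. degree (coeff G l) \<le> e1)"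

definition biev :: "nat \<Rightarrow> nat \<Rightarrow> 'a::comm_ring_1 poly poly \<Rightarrow> 'a \<Rightarrow> 'a \<Rightarrow> 'a \<Rightarrow> 'a \<Rightarrow> 'a" where
  "biev e1 e2 G x1 x2 y1 y2 =
     (\<Sum>l\<le>e2. \<Sum>j\<le>e1. coeff (coeff G l) j * (x1 ^ (e1 - j) * x2 ^ j) * (y1 ^ (e2 - l) * y2 ^ l))"

definition ev2 :: "'a::comm_ring_1 poly poly \<Rightarrow> 'a \<Rightarrow> 'a \<Rightarrow> 'a" where
  "ev2 G t u = poly (poly G [:u:]) t"

lemma hpoly_0 [simp]: "hpoly e 0 a b = 0"
  by (simp add: hpoly_def)

lemma hpoly_add: "hpoly e (p + q) a b = hpoly e p a b + hpoly e q a b"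
  by (simp add: hpoly_def sum.distrib algebra_simps)

lemma hpoly_smult: "hpoly e (smult c p) a b = c * hpoly e p a b"
  by (simp add: hpoly_def sum_distrib_left algebra_simps)

lemma hpoly_pCons: "hpoly (Suc e) (pCons c p) a b = c * a ^ Suc e + b * hpoly e p a b"
  unfolding hpoly_def sum.atMost_Suc_shift by (simp add: sum_distrib_left algebra_simps)

lemma hpoly_Suc: "degree p \<le> e \<Longrightarrow> hpoly (Suc e) p a b = a * hpoly e p a b"
  by (simp add: hpoly_def coeff_eq_0 sum_distrib_left algebra_simps Suc_diff_le)

lemma hpoly_add_degree: "degree p \<le> e \<Longrightarrow> hpoly (n + e) p a b = a ^ n * hpoly e p a b"
  by (induction n) (simp_all add: hpoly_Suc algebra_simps)

text \<open>Formal degrees add under multiplication. The induction strips the lowest coefficient of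
  \<open>p\<close> and lowers \<open>m\<close> with it; a constant \<open>p\<close> is treated apart
  because then \<open>m\<close> may be 0.\<close>

lemma hpoly_mult:
  assumes "degree p \<le> m" "degree q \<le> n"
  shows "hpoly (m + n) (p * q) a b = hpoly m p a b * hpoly n q a b"
  using assms(1)
proof (induction p arbitrary: m)
  case 0
  then show ?case by simp
next
  case (pCons c p)
  show ?case
  proof (cases "p = 0")
    case True
    then have "hpoly m (pCons c p) a b = c * a ^ m"
      using hpoly_add_degree[of "[:c:]" 0 m a b] by (simp add: hpoly_def)
    then show ?thesis
      using True assms(2) by (simp add: hpoly_smult hpoly_add_degree)
  next
    case False
    then obtain m' where m: "m = Suc m'" "degree p \<le> m'"
      using pCons.prems by (cases m) auto
    have "hpoly (m + n) (pCons c p * q) a b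
        = c * hpoly (m + n) q a b + b * hpoly (m' + n) (p * q) a b"
      by (simp add: m hpoly_add hpoly_smult hpoly_pCons)
    also have "\<dots> = hpoly m (pCons c p) a b * hpoly n q a b"
      using assms(2) hpoly_add_degree[OF assms(2), of "Suc m'" a b]
      by (simp add: m hpoly_pCons pCons.IH[OF m(2)] algebra_simps)
    finally show ?thesis .
  qed
qed

lemma coeff_hpoly_const:
  "coeff (hpoly e G [:a:] [:b:]) j = (\<Sum>l\<le>e. coeff (coeff G l) j * (a ^ (e - l) * b ^ l))"
proof -
  have [simp]: "[:a:] ^ k = [:a ^ k:]" for k and a :: 'a
    by (induction k) (simp_all add: one_pCons)
  show ?thesis
    by (simp add: hpoly_def coeff_sum mult_ac)
qed

text \<open>Homogenising first in \<open>u\<close>, with polynomials in \<open>t\<close> as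
  coefficients, and then in \<open>t\<close> carries the univariate facts on \<open>hpoly\<close>
  over to two variables.\<close>

lemma biev_nested: "biev e1 e2 G x1 x2 y1 y2 = hpoly e1 (hpoly e2 G [:y1:] [:y2:]) x1 x2"
  unfolding biev_def
  by (subst sum.swap) (simp add: hpoly_def[of e1] coeff_hpoly_const sum_distrib_left sum_distrib_right mult_ac)

lemma degree_hpoly_const_le:
  assumes "bideg_le e1 e2 G"
  shows "degree (hpoly e2 G [:a:] [:b:]) \<le> e1"
proof (intro degree_le allI impI)
  fix i assume "e1 < i"
  then have "coeff (coeff G l) i = 0" for l
    using assms by (intro coeff_eq_0) (auto simp: bideg_le_def intro: le_less_trans)
  then show "coeff (hpoly e2 G [:a:] [:b:]) i = 0"
    by (simp add: coeff_hpoly_const)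
qed

lemma biev_mult:
  assumes "bideg_le a1 a2 A" "bideg_le b1 b2 B"
  shows "biev (a1 + b1) (a2 + b2) (A * B) x1 x2 y1 y2 = biev a1 a2 A x1 x2 y1 y2 * biev b1 b2 B x1 x2 y1 y2"
  using assms degree_hpoly_const_le[OF assms(1)] degree_hpoly_const_le[OF assms(2)]
  by (simp add: biev_nested hpoly_mult bideg_le_def)

lemma biev_add_degree:
  assumes "bideg_le a1 a2 A"
  shows "biev (n1 + a1) (n2 + a2) A x1 x2 y1 y2 = x1 ^ n1 * y1 ^ n2 * biev a1 a2 A x1 x2 y1 y2"
proof -
  have "[:y1:] ^ n2 = [:y1 ^ n2:]"
    by (induction n2) (simp_all add: one_pCons)
  then show ?thesis
    using assms degree_hpoly_const_le[OF assms, of y1 y2]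
    by (simp add: biev_nested hpoly_add_degree bideg_le_def hpoly_smult)
qed

lemma poly_altdef_le:
  fixes p :: "'a::comm_semiring_1 poly"
  assumes "degree p \<le> e"
  shows "poly p t = (\<Sum>i\<le>e. coeff p i * t ^ i)"
  by (simp only: poly_altdef, rule sum.mono_neutral_left) (use assms in \<open>auto intro: le_degree\<close>)

lemma hpoly_scale: "degree p \<le> e \<Longrightarrow> hpoly e p a (t * a) = a ^ e * poly p t"
proof -
  assume "degree p \<le> e"
  then have "a ^ e * poly p t = (\<Sum>i\<le>e. a ^ e * (coeff p i * t ^ i))"
    by (simp add: poly_altdef_le sum_distrib_left)
  also have "\<dots> = hpoly e p a (t * a)"
    unfolding hpoly_def
  proof (intro sum.cong refl)
    fix i assume "i \<in> {..e}"
    then have "a ^ e = a ^ (e - i) * a ^ i"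
      by (simp flip: power_add)
    then show "a ^ e * (coeff p i * t ^ i) = coeff p i * a ^ (e - i) * (t * a) ^ i"
      by (simp add: power_mult_distrib)
  qed
  finally show ?thesis by simp
qed

text \<open>Writing \<open>x2 = t * x1\<close> and \<open>y2 = u * y1\<close> avoids division, so
  the identity serves both for rational slopes and for integers representing slopes modulo a prime
  power.\<close>

lemma biev_scale:
  assumes "bideg_le e1 e2 G"
  shows "biev e1 e2 G x1 (t * x1) y1 (u * y1) = x1 ^ e1 * y1 ^ e2 * ev2 G t u"
proof -
  have "[:y1:] ^ k = [:y1 ^ k:]" for k
    by (induction k) (simp_all add: one_pCons)
  moreover have "hpoly e2 G [:y1:] ([:u:] * [:y1:]) = [:y1:] ^ e2 * poly G [:u:]"
    using assms by (intro hpoly_scale) (simp add: bideg_le_def)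
  ultimately have "hpoly e2 G [:y1:] [:u * y1:] = smult (y1 ^ e2) (poly G [:u:])"
    by (simp add: mult.commute)
  moreover have "degree (poly G [:u:]) \<le> e1"
    using degree_hpoly_const_le[OF assms, of 1 u] hpoly_scale[of G e2 1 "[:u:]"] assms
    by (simp add: bideg_le_def flip: one_pCons)
  ultimately show ?thesis
    using assms by (simp add: biev_nested hpoly_smult hpoly_scale ev2_def)
qed

section \<open>Homogenisation back to four variables\<close>

lemma map_poly_hom_mult:
  fixes h :: "'a::comm_ring_1 \<Rightarrow> 'b::comm_ring_1"
  assumes "h 0 = 0" "\<And>x y. h (x + y) = h x + h y" "\<And>x y. h (x * y) = h x * h y"
  shows "map_poly h (p * q) = map_poly h p * map_poly h q"
proof (rule poly_eqI)
  have sum: "h (sum f A) = (\<Sum>x\<in>A. h (f x))" for f :: "nat \<Rightarrow> 'a" and A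
    using assms by (induction A rule: infinite_finite_induct) auto
  show "coeff (map_poly h (p * q)) n = coeff (map_poly h p * map_poly h q) n" for n
    by (simp add: coeff_map_poly assms coeff_mult sum)
qed

lemma bideg_le_map_poly:
  assumes "bideg_le e1 e2 G" "h 0 = 0"
  shows "bideg_le e1 e2 (map_poly (map_poly h) G)"
  using assms by (auto simp: bideg_le_def coeff_map_poly intro: order_trans[OF map_poly_degree_leq])

lemma map_poly_hom_add:
  assumes "h 0 = 0" "\<And>x y. h (x + y) = h x + h y"
  shows "map_poly h (p + q) = map_poly h p + map_poly h q"
  by (rule poly_eqI) (simp add: coeff_map_poly assms)

text \<open>This is \<open>biev\<close> evaluated at the four variables themselves, so that
  multiplicativity comes from \<open>biev_mult\<close> without computing coefficients.\<close>

definition hom4 :: "nat \<Rightarrow> nat \<Rightarrow> 'a::comm_ring_1 poly poly \<Rightarrow> 'a mpoly4" where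
  "hom4 a1 a2 A = biev a1 a2 (map_poly (map_poly (\<lambda>c. [:[:[:[:c:]:]:]:])) A)
     [:[:[:[:0, 1:]:]:]:] [:[:[:0, 1:]:]:] [:[:0, 1:]:] [:0, 1:]"

lemma coeff4_sum: "coeff4 (sum f A) i j k l = (\<Sum>x\<in>A. coeff4 (f x) i j k l)"
  by (simp add: coeff4_def coeff_sum)

lemma coeff4_monom:
  "coeff4 (monom (monom (monom (monom c i') j') k') l') i j k l
    = (if i' = i \<and> j' = j \<and> k' = k \<and> l' = l then c else 0)"
  by (simp add: coeff4_def)

lemma mpoly4_eqI: "(\<And>i j k l. coeff4 p i j k l = coeff4 q i j k l) \<Longrightarrow> p = q"
  by (intro poly_eqI) (simp add: coeff4_def)

lemma monomial4:
  "[:[:[:[:c:]:]:]:] * ([:[:[:[:0, 1:]:]:]:] ^ i * [:[:[:0, 1:]:]:] ^ j) * ([:[:0, 1:]:] ^ k * [:0, 1:] ^ l)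
    = monom (monom (monom (monom c i) j) k) l" for c :: "'a::comm_ring_1"
proof -
  have const: "[:a:] ^ n = [:a ^ n:]" for a :: "'b::comm_ring_1" and n
    by (induction n) (simp_all add: one_pCons)
  have X: "[:0, 1:] ^ n = monom (1::'b::comm_ring_1) n" for n
    by (simp add: monom_altdef)
  show ?thesis
    by (simp add: const X smult_monom)
qed

lemma hom4_altdef:
  "hom4 a1 a2 A = (\<Sum>l\<le>a2. \<Sum>j\<le>a1.
      monom (monom (monom (monom (coeff (coeff A l) j) (a1 - j)) j) (a2 - l)) l)"
proof -
  have c: "coeff (coeff (map_poly (map_poly (\<lambda>c. [:[:[:[:c:]:]:]:])) A) l) j = [:[:[:[:coeff (coeff A l) j:]:]:]:]" for l j
    by (simp add: coeff_map_poly)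
  show ?thesis
    unfolding hom4_def biev_def monomial4[symmetric] by (simp only: c)
qed

lemma coeff4_hom4:
  "coeff4 (hom4 a1 a2 A) i j k l = (if i + j = a1 \<and> k + l = a2 then coeff (coeff A l) j else 0)"
proof -
  have "coeff4 (hom4 a1 a2 A) i j k l = (\<Sum>l'\<le>a2. \<Sum>j'\<le>a1. if l' = l then if j' = j then
        (if a2 - l = k \<and> a1 - j = i then coeff (coeff A l) j else 0) else 0 else 0)"
    by (simp only: hom4_altdef coeff4_sum coeff4_monom, intro sum.cong refl) auto
  also have "\<dots> = (\<Sum>l'\<le>a2. if l' = l then (if j \<le> a1 \<and> a2 - l = k \<and> a1 - j = i then coeff (coeff A l) j else 0) else 0)"
    by (intro sum.cong refl) simp
  also have "\<dots> = (if i + j = a1 \<and> k + l = a2 then coeff (coeff A l) j else 0)"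
    by auto
  finally show ?thesis .
qed

lemma hom4_mult:
  fixes A B :: "'a::comm_ring_1 poly poly"
  assumes A: "bideg_le a1 a2 A" and B: "bideg_le b1 b2 B"
  shows "hom4 (a1 + b1) (a2 + b2) (A * B) = hom4 a1 a2 A * hom4 b1 b2 B"
proof -
  let ?c = "\<lambda>c::'a. [:[:[:[:c:]:]:]:]"
  have "map_poly (map_poly ?c) (A * B) = map_poly (map_poly ?c) A * map_poly (map_poly ?c) B"
    by (intro map_poly_hom_mult map_poly_hom_add) auto
  moreover have "bideg_le a1 a2 (map_poly (map_poly ?c) A)" "bideg_le b1 b2 (map_poly (map_poly ?c) B)"
    using A B by (simp_all add: bideg_le_map_poly)
  ultimately show ?thesis
    unfolding hom4_def by (simp only: biev_mult)
qed

lemma hom4_add_degree: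
  fixes A :: "'a::comm_ring_1 poly poly"
  assumes A: "bideg_le a1 a2 A"
  shows "hom4 (n1 + a1) (n2 + a2) A = [:[:[:[:0, 1:]:]:]:] ^ n1 * [:[:0, 1:]:] ^ n2 * hom4 a1 a2 A"
proof -
  let ?c = "\<lambda>c::'a. [:[:[:[:c:]:]:]:]"
  have "bideg_le a1 a2 (map_poly (map_poly ?c) A)"
    using A by (simp add: bideg_le_map_poly)
  then show ?thesis
    unfolding hom4_def by (rule biev_add_degree)
qed

section \<open>Dehomogenisation of a bihomogeneous polynomial\<close>

definition bipoly :: "nat \<Rightarrow> nat \<Rightarrow> (nat \<times> nat \<Rightarrow> 'a::comm_ring_1) \<Rightarrow> 'a poly poly" where
  "bipoly e1 e2 c = (\<Sum>l\<le>e2. monom (\<Sum>j\<le>e1. monom (c (j, l)) j) l)"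

lemma coeff_bipoly: "coeff (coeff (bipoly e1 e2 c) l) j = (if l \<le> e2 \<and> j \<le> e1 then c (j, l) else 0)"
proof -
  have "coeff (bipoly e1 e2 c) l = (if l \<le> e2 then \<Sum>j\<le>e1. monom (c (j, l)) j else 0)"
    by (simp add: bipoly_def coeff_sum coeff_monom)
  then show ?thesis
    by (simp add: coeff_sum coeff_monom)
qed

lemma bideg_le_bipoly: "bideg_le e1 e2 (bipoly e1 e2 c)"
  unfolding bideg_le_def
  by (intro conjI allI degree_le impI poly_eqI) (simp_all add: coeff_bipoly)

text \<open>For bihomogeneous \<open>f\<close> this sets \<open>X1 = Y1 = 1\<close>: the exponents
  of \<open>X2\<close> and \<open>Y2\<close> determine the monomial, so its coefficient can be read
  off directly.\<close>

definition dehom :: "nat \<Rightarrow> nat \<Rightarrow> 'a::comm_ring_1 mpoly4 \<Rightarrow> 'a poly poly" where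
  "dehom d1 d2 f = bipoly d1 d2 (\<lambda>(j, l). coeff4 f (d1 - j) j (d2 - l) l)"

lemma coeff_dehom:
  "coeff (coeff (dehom d1 d2 f) l) j
    = (if l \<le> d2 \<and> j \<le> d1 then coeff4 f (d1 - j) j (d2 - l) l else 0)"
  by (simp add: dehom_def coeff_bipoly)

lemma bideg_le_dehom: "bideg_le d1 d2 (dehom d1 d2 f)"
  by (simp add: dehom_def bideg_le_bipoly)

lemma hom4_dehom: "bihomogeneous f d1 d2 \<Longrightarrow> hom4 d1 d2 (dehom d1 d2 f) = f"
  unfolding bihomogeneous_def
  by (intro mpoly4_eqI) (auto simp: coeff4_hom4 coeff_dehom)

section \<open>Top coefficients and irreducibility of the affine equation\<close>

lemma hpoly_0_1: "hpoly e p 0 1 = coeff p e"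
proof -
  have "hpoly e p 0 1 = (\<Sum>i\<le>e. if i = e then coeff p i else 0)"
    unfolding hpoly_def by (intro sum.cong refl) (auto simp: power_0_left)
  then show ?thesis
    by simp
qed

text \<open>Multiplicativity of the homogenisation, evaluated at the point \<open>(0, 1)\<close> at
  infinity.\<close>

lemma coeff_mult_top:
  fixes p q :: "'a::comm_ring_1 poly"
  assumes "degree p \<le> m" "degree q \<le> n"
  shows "coeff (p * q) (m + n) = coeff p m * coeff q n"
  using hpoly_mult[OF assms, of 0 1] by (simp add: hpoly_0_1)

text \<open>The degree in \<open>t\<close> is additive: the coefficients of the highest power of
  \<open>t\<close> in \<open>A\<close> and in \<open>B\<close> form nonzero polynomials in
  \<open>u\<close>, whose product is nonzero over a domain.\<close>

lemma bideg_le_add_mult: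
  fixes A B :: "'a::idom poly poly"
  assumes AB: "bideg_le d1 d2 (A * B)" "A * B \<noteq> 0"
  obtains a1 b1 where "bideg_le a1 (degree A) A" "bideg_le b1 (degree B) B" "a1 + b1 \<le> d1"
proof -
  have ex: "\<exists>a. bideg_le a (degree A) A \<and> map_poly (\<lambda>c. coeff c a) A \<noteq> 0" if "A \<noteq> 0" for A :: "'a poly poly"
  proof -
    define a where "a = Max ((\<lambda>l. degree (coeff A l)) ` {..degree A})"
    have le: "degree (coeff A l) \<le> a" for l
      by (cases "l \<le> degree A") (auto simp: a_def coeff_eq_0)
    have "a \<in> (\<lambda>l. degree (coeff A l)) ` {..degree A}"
      unfolding a_def by (rule Max_in) auto
    then obtain l where l: "degree (coeff A l) = a"
      by auto
    have "\<exists>l. coeff (coeff A l) a \<noteq> 0"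
    \<comment> \<open>The maximum can be attained at a zero coefficient only if it is 0; then the
      leading coefficient of \<open>A\<close> is a nonzero constant.\<close>
    proof (cases "coeff A l = 0")
      case True
      then show ?thesis
        using l le[of "degree A"] that by (intro exI[of _ "degree A"]) (auto elim!: degree_eq_zeroE)
    next
      case False
      then show ?thesis
        using l by (intro exI[of _ l]) auto
    qed
    then have "map_poly (\<lambda>c. coeff c a) A \<noteq> 0"
      by (auto simp: poly_eq_iff coeff_map_poly)
    with le show ?thesis
      by (auto simp: bideg_le_def)
  qed
  from AB ex[of A] ex[of B] obtain a b
    where a: "bideg_le a (degree A) A" "map_poly (\<lambda>c. coeff c a) A \<noteq> 0"
      and b: "bideg_le b (degree B) B" "map_poly (\<lambda>c. coeff c b) B \<noteq> 0"
    by auto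
  have "map_poly (\<lambda>c. coeff c (a + b)) (A * B)
      = map_poly (\<lambda>c. coeff c a) A * map_poly (\<lambda>c. coeff c b) B"
  proof (rule poly_eqI)
    fix n
    have "coeff (coeff (A * B) n) (a + b) = (\<Sum>i\<le>n. coeff (coeff A i * coeff B (n - i)) (a + b))"
      by (simp only: coeff_mult[of A B] coeff_sum)
    also have "\<dots> = (\<Sum>i\<le>n. coeff (coeff A i) a * coeff (coeff B (n - i)) b)"
      using a b by (intro sum.cong refl coeff_mult_top) (auto simp: bideg_le_def)
    finally show "coeff (map_poly (\<lambda>c. coeff c (a + b)) (A * B)) n
        = coeff (map_poly (\<lambda>c. coeff c a) A * map_poly (\<lambda>c. coeff c b) B) n"
      by (simp add: coeff_map_poly coeff_mult[of "map_poly _ _"])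
  qed
  also have "\<dots> \<noteq> 0"
    using a b by simp
  finally obtain l where "coeff (coeff (A * B) l) (a + b) \<noteq> 0"
    by (auto simp: poly_eq_iff coeff_map_poly)
  then have "a + b \<le> degree (coeff (A * B) l)"
    by (rule le_degree)
  also have "\<dots> \<le> d1"
    using AB by (simp add: bideg_le_def)
  finally show ?thesis
    using a b that by blast
qed

lemma is_unit_mpoly4E:
  fixes p :: "'a::field mpoly4"
  assumes "p dvd 1"
  obtains c where "c \<noteq> 0" "p = [:[:[:[:c:]:]:]:]"
proof -
  from assms obtain c where "p = [:[:[:[:c:]:]:]:]" "c dvd 1"
    by (auto simp: is_unit_poly_iff)
  then show ?thesis
    using that by (cases "c = 0") auto
qed

lemma coeff4_unit: "coeff4 [:[:[:[:c:]:]:]:] i j k l = (if i = 0 \<and> j = 0 \<and> k = 0 \<and> l = 0 then c else 0)"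
  by (auto simp: coeff4_def coeff_pCons split: nat.splits)

context
  fixes f :: "'a::field mpoly4" and d1 d2 :: nat
  assumes bihom: "bihomogeneous f d1 d2" and d: "d1 \<ge> 1" "d2 \<ge> 1" and irr: "irreducible f"
begin

text \<open>If the degree in \<open>u\<close> dropped, \<open>Y1\<close> would divide
  \<open>f\<close>. By irreducibility the cofactor would be constant, but it is homogeneous of
  degree \<open>d1 >= 1\<close> in \<open>X1, X2\<close>.\<close>

lemma degree_dehom: "degree (dehom d1 d2 f) = d2"
proof (rule ccontr)
  let ?F = "dehom d1 d2 f" and ?Y = "[:[:0, 1:]:] :: 'a mpoly4"
  assume "degree ?F \<noteq> d2"
  then have F: "bideg_le d1 (d2 - 1) ?F"
    using bideg_le_dehom[of d1 d2 f] by (auto simp: bideg_le_def)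
  have "f = ?Y * hom4 d1 (d2 - 1) ?F"
    using hom4_add_degree[OF F, of 0 1] hom4_dehom[OF bihom] d by simp
  then have "?Y dvd 1 \<or> hom4 d1 (d2 - 1) ?F dvd 1"
    using irr irreducibleD by blast
  moreover have "\<not> ?Y dvd 1"
    by (simp add: is_unit_poly_iff)
  ultimately obtain c where c: "c \<noteq> 0" "hom4 d1 (d2 - 1) ?F = [:[:[:[:c:]:]:]:]"
    by (auto elim: is_unit_mpoly4E)
  from c have "coeff4 (hom4 d1 (d2 - 1) ?F) 0 0 0 0 \<noteq> 0"
    by (simp add: coeff4_unit)
  then show False
    using d by (simp add: coeff4_hom4 split: if_splits)
qed

text \<open>Otherwise \<open>X1\<close> would divide \<open>f\<close>, which is excluded in the same
  way.\<close>

lemma ex_coeff_dehom: "\<exists>l. coeff (coeff (dehom d1 d2 f) l) d1 \<noteq> 0"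
proof (rule ccontr)
  let ?F = "dehom d1 d2 f" and ?X = "[:[:[:[:0, 1:]:]:]:] :: 'a mpoly4"
  assume *: "\<not> ?thesis"
  have "degree (coeff ?F l) \<le> d1 - 1" for l
  proof (intro degree_le allI impI)
    show "coeff (coeff ?F l) i = 0" if "d1 - 1 < i" for i
      using * that by (cases "i = d1") (auto simp: coeff_dehom)
  qed
  then have F: "bideg_le (d1 - 1) d2 ?F"
    using bideg_le_dehom[of d1 d2 f] by (auto simp: bideg_le_def)
  have "f = ?X * hom4 (d1 - 1) d2 ?F"
    using hom4_add_degree[OF F, of 1 0] hom4_dehom[OF bihom] d by simp
  then have "?X dvd 1 \<or> hom4 (d1 - 1) d2 ?F dvd 1"
    using irr irreducibleD by blast
  moreover have "\<not> ?X dvd 1"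
    by (simp add: is_unit_poly_iff)
  ultimately obtain c where c: "c \<noteq> 0" "hom4 (d1 - 1) d2 ?F = [:[:[:[:c:]:]:]:]"
    by (auto elim: is_unit_mpoly4E)
  from c have "coeff4 (hom4 (d1 - 1) d2 ?F) 0 0 0 0 \<noteq> 0"
    by (simp add: coeff4_unit)
  then show False
    using d by (simp add: coeff4_hom4 split: if_splits)
qed

text \<open>A factorisation homogenises to one of \<open>f\<close>. One of the forms is then a unit,
  hence a constant of bidegree \<open>(0, 0)\<close>, and so is the factor it came from.\<close>

lemma irreducible_dehom: "irreducible (dehom d1 d2 f)"
proof (rule irreducibleI)
  let ?F = "dehom d1 d2 f"
  show "?F \<noteq> 0"
    using degree_dehom d by auto
  show "\<not> ?F dvd 1"
    using degree_dehom d by (auto simp: is_unit_poly_iff)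
  fix A B assume AB: "?F = A * B"
  with \<open>?F \<noteq> 0\<close> bideg_le_dehom[of d1 d2 f] obtain a b
    where a: "bideg_le a (degree A) A" and b: "bideg_le b (degree B) B" and ab: "a + b \<le> d1"
    by (metis bideg_le_add_mult)
  have deg: "degree A + degree B = d2"
    using degree_dehom AB \<open>?F \<noteq> 0\<close> by (simp add: degree_mult_eq)
  \<comment> \<open>The formal degree of \<open>B\<close> in \<open>t\<close> is raised to
    \<open>d1 - a\<close> so that the formal degrees add up to exactly \<open>d1\<close>, while only
    \<open>a + b <= d1\<close> is known.\<close>
  have b': "bideg_le (d1 - a) (degree B) B"
    unfolding bideg_le_def
  proof (intro conjI allI order.refl)
    fix l
    have "degree (coeff B l) \<le> b"
      using b by (simp add: bideg_le_def)
    then show "degree (coeff B l) \<le> d1 - a"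
      using ab by simp
  qed
  have "f = hom4 (a + (d1 - a)) (degree A + degree B) (A * B)"
    using hom4_dehom[OF bihom] AB ab deg by simp
  also have "\<dots> = hom4 a (degree A) A * hom4 (d1 - a) (degree B) B"
    by (intro hom4_mult a b')
  finally have "hom4 a (degree A) A dvd 1 \<or> hom4 (d1 - a) (degree B) B dvd 1"
    using irr irreducibleD by blast
  moreover have unit: "G dvd 1" if "bideg_le e1 e2 G" "hom4 e1 e2 G dvd 1" for e1 e2 and G :: "'a poly poly"
  proof -
    from that(2) obtain c where c: "c \<noteq> 0" "hom4 e1 e2 G = [:[:[:[:c:]:]:]:]"
      by (rule is_unit_mpoly4E)
    have e: "e1 = 0" "e2 = 0"
      using arg_cong[OF c(2), of "\<lambda>p. coeff4 p 0 0 0 0"] c(1)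
      by (auto simp: coeff4_unit coeff4_hom4 split: if_splits)
    have "coeff (coeff G 0) 0 = c"
      using arg_cong[OF c(2), of "\<lambda>p. coeff4 p 0 0 0 0"] e by (simp add: coeff4_unit coeff4_hom4)
    moreover have "degree (coeff G 0) = 0" "degree G = 0"
      using that(1) e by (auto simp: bideg_le_def)
    ultimately show ?thesis
      using c(1) by (auto elim!: degree_eq_zeroE simp: is_unit_poly_iff dvd_field_iff)
  qed
  ultimately show "A dvd 1 \<or> B dvd 1"
    using a b' unit by blast
qed

end

section \<open>Common zeros of two plane curves\<close>

lemma ev2_mult: "ev2 (G * H) t u = ev2 G t u * ev2 H t u"
  by (simp add: ev2_def)

lemma ev2_altdef:
  assumes "degree G < n"
  shows "ev2 G t u = (\<Sum>j<n. poly (coeff G j) t * u ^ j)"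
proof -
  have "[:u:] ^ j = [:u ^ j:]" for j
    by (induction j) (simp_all add: one_pCons)
  moreover have "poly G [:u:] = (\<Sum>j<n. coeff G j * [:u:] ^ j)"
    unfolding poly_altdef
    by (rule sum.mono_neutral_left) (use assms in \<open>auto intro: le_degree\<close>)
  ultimately show ?thesis
    by (simp add: ev2_def poly_sum mult.commute)
qed

text \<open>Every term of the Leibniz expansion takes one entry from each row, so bounds by rows add
  up.\<close>

lemma degree_det_le:
  fixes A :: "'a::idom poly mat"
  assumes A: "A \<in> carrier_mat n n" and deg: "\<And>i j. i < n \<Longrightarrow> j < n \<Longrightarrow> degree (A $$ (i, j)) \<le> r i"
  shows "degree (det A) \<le> sum r {0..<n}"
  unfolding det_def'[OF A]
proof (rule degree_sum_le)
  show "finite {p. p permutes {0..<n}}"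
    by (simp add: finite_permutations)
  fix p assume "p \<in> {p. p permutes {0..<n}}"
  then have p: "p i < n" if "i < n" for i
    using that permutes_in_image[of p "{0..<n}" i] by simp
  have "degree (signof p * (\<Prod>i = 0..<n. A $$ (i, p i))) \<le> degree (signof p :: 'a poly) + degree (\<Prod>i = 0..<n. A $$ (i, p i))"
    by (rule degree_mult_le)
  also have "degree (signof p :: 'a poly) = 0"
    by (simp add: sign_def)
  also have "degree (\<Prod>i = 0..<n. A $$ (i, p i)) \<le> (\<Sum>i = 0..<n. degree (A $$ (i, p i)))"
    using degree_prod_sum_le[of "{0..<n}" "\<lambda>i. A $$ (i, p i)"] by simp
  also have "\<dots> \<le> sum r {0..<n}"
    using p deg by (intro sum_mono) auto
  finally show "degree (signof p * (\<Prod>i = 0..<n. A $$ (i, p i))) \<le> sum r {0..<n}"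
    by simp
qed

lemma poly_det:
  fixes A :: "'a::idom poly mat"
  assumes A: "A \<in> carrier_mat n n"
  shows "poly (det A) t = det (map_mat (\<lambda>p. poly p t) A)"
proof -
  have "poly (signof p) t = signof p" for p :: "nat \<Rightarrow> nat"
    by (simp add: sign_def)
  moreover have "p i < n" if "p permutes {0..<n}" "i < n" for p i
    using that permutes_in_image[of p "{0..<n}" i] by simp
  moreover have "map_mat (\<lambda>p. poly p t) A \<in> carrier_mat n n"
    using A by simp
  ultimately show ?thesis
    using A by (simp add: det_def'[OF A] det_def'[of _ n] poly_sum poly_prod)
qed

text \<open>The rows of the Sylvester matrix are laid out for the formal degree \<open>e2\<close>, so the degree of
  \<open>G\<close> in the outer variable may be smaller.\<close>

theorem card_common_zeros_le:
  fixes F G :: "'a::field_gcd poly poly"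
  assumes F: "irreducible F" "degree F = d2" "bideg_le d1 d2 F" and d2: "d2 \<ge> 1"
    and G: "bideg_le e1 e2 G" "\<not> F dvd G"
  shows "finite {t. \<exists>u. ev2 F t u = 0 \<and> ev2 G t u = 0}"
    and "card {t. \<exists>u. ev2 F t u = 0 \<and> ev2 G t u = 0} \<le> d1 * e2 + d2 * e1"
proof -
  define n where "n = e2 + d2"
  \<comment> \<open>The Sylvester rows: \<open>e2\<close> shifts of \<open>F\<close>, then
    \<open>d2\<close> shifts of \<open>G\<close>.\<close>
  define row where "row i = (if i < e2 then monom 1 i * F else monom 1 (i - e2) * G)" for i
  define S where "S = mat n n (\<lambda>(i, j). coeff (row i) j)"
  have S: "S \<in> carrier_mat n n" and S_idx: "i < n \<Longrightarrow> j < n \<Longrightarrow> S $$ (i, j) = coeff (row i) j" for i j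
    by (simp_all add: S_def)
  have "F \<noteq> 0" "G \<noteq> 0"
    using F G by auto
  have deg_row: "degree (row i) < n" if "i < n" for i
    using that F(2) G(1) degree_mult_le[of "monom 1 i" F] degree_mult_le[of "monom 1 (i - e2)" G]
    by (auto simp: row_def n_def bideg_le_def degree_monom_eq)
  \<comment> \<open>A vanishing determinant yields \<open>P * F + Q * G = 0\<close> with
    \<open>P\<close> of degree below \<open>e2\<close> and \<open>Q\<close> of degree below
    \<open>d2\<close>. The prime \<open>F\<close> does not divide \<open>G\<close>, so it divides
    \<open>Q\<close>; hence \<open>Q = 0\<close> by degree, and then \<open>P = 0\<close>.\<close>
  have det_nz: "det S \<noteq> 0"
  proof
    assume "det S = 0"
    then have "det (transpose_mat S) = 0"
      using det_transpose[OF S] by simp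
    then obtain v where v: "v \<in> carrier_vec n" "v \<noteq> 0\<^sub>v n" "transpose_mat S *\<^sub>v v = 0\<^sub>v n"
      using det_0_iff_vec_prod_zero[of "transpose_mat S" n] S by auto
    have "(\<Sum>i<n. smult (v $ i) (row i)) = 0"
    proof (rule poly_eqI)
      fix j
      show "coeff (\<Sum>i<n. smult (v $ i) (row i)) j = coeff 0 j"
      proof (cases "j < n")
        case True
        have "(transpose_mat S *\<^sub>v v) $ j = (\<Sum>i<n. coeff (row i) j * v $ i)"
          using S v(1) True by (simp add: scalar_prod_def S_idx atLeast0LessThan)
        then show ?thesis
          using True by (simp add: v(3) coeff_sum mult.commute)
      next
        case False
        then have "coeff (row i) j = 0" if "i < n" for i
          using deg_row[OF that] by (intro coeff_eq_0) simp
        then show ?thesis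
          by (simp add: coeff_sum)
      qed
    qed
    define P where "P = (\<Sum>i<e2. monom (v $ i) i)"
    define Q where "Q = (\<Sum>i<d2. monom (v $ (e2 + i)) i)"
    have "(\<Sum>i<n. smult (v $ i) (row i)) = (\<Sum>i<e2. smult (v $ i) (row i)) + (\<Sum>i<d2. smult (v $ (e2 + i)) (row (e2 + i)))"
      unfolding n_def by (induction d2) (simp_all add: add.assoc)
    also have "\<dots> = P * F + Q * G"
      by (simp add: row_def P_def Q_def sum_distrib_right smult_monom flip: mult_smult_left)
    finally have rel: "P * F + Q * G = 0"
      using \<open>(\<Sum>i<n. smult (v $ i) (row i)) = 0\<close> by simp
    have coeff_Q: "coeff Q i = (if i < d2 then v $ (e2 + i) else 0)" for i
      by (simp add: Q_def coeff_sum)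
    have coeff_P: "coeff P i = (if i < e2 then v $ i else 0)" for i
      by (simp add: P_def coeff_sum)
    have "Q * G = F * (- P)"
      using rel by (simp add: add_eq_0_iff mult.commute)
    then have "F dvd Q * G"
      by simp
    then have "F dvd Q"
      using F(1) G(2) by (simp add: prime_elem_iff_irreducible[symmetric] prime_elem_dvd_mult_iff)
    have "Q = 0"
    proof (rule ccontr)
      assume "Q \<noteq> 0"
      then have "d2 \<le> degree Q"
        using \<open>F dvd Q\<close> F(2) dvd_imp_degree_le by blast
      then show False
        using coeff_Q[of "degree Q"] \<open>Q \<noteq> 0\<close> by simp
    qed
    moreover from this rel \<open>F \<noteq> 0\<close> have "P = 0"
      by simp
    ultimately have "v $ i = 0" if "i < n" for i
      using that coeff_P[of i] coeff_Q[of "i - e2"] by (cases "i < e2") (auto simp: n_def split: if_splits)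
    then have "v = 0\<^sub>v n"
      using v(1) by (intro eq_vecI) auto
    then show False
      using v(2) by simp
  qed
  have deg: "degree (det S) \<le> d1 * e2 + d2 * e1"
  proof -
    have "degree (coeff (row i) j) \<le> (if i < e2 then d1 else e1)" for i j
      using F(3) G(1) by (auto simp: row_def coeff_monom_mult bideg_le_def)
    then have "degree (det S) \<le> (\<Sum>i = 0..<n. if i < e2 then d1 else e1)"
      by (intro degree_det_le[OF S]) (simp add: S_idx)
    also have "\<dots> = d1 * e2 + d2 * e1"
      unfolding n_def atLeast0LessThan by (induction d2) simp_all
    finally show ?thesis .
  qed
  \<comment> \<open>At a common zero the vector of powers of \<open>u\<close> lies in the kernel of
    the evaluated matrix. Its entry at index 0 is 1, so it is nonzero and \<open>t\<close> is a root
    of the determinant.\<close>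
  have sub: "{t. \<exists>u. ev2 F t u = 0 \<and> ev2 G t u = 0} \<subseteq> {t. poly (det S) t = 0}"
  proof safe
    fix t u assume zero: "ev2 F t u = 0" "ev2 G t u = 0"
    define w where "w = vec n (\<lambda>j. u ^ j)"
    have n: "n > 0"
      using d2 by (simp add: n_def)
    have "map_mat (\<lambda>p. poly p t) S *\<^sub>v w = 0\<^sub>v n"
    proof (rule eq_vecI)
      fix i assume "i < dim_vec (0\<^sub>v n :: 'a vec)"
      then have i: "i < n"
        by simp
      have "(map_mat (\<lambda>p. poly p t) S *\<^sub>v w) $ i = (\<Sum>j<n. poly (coeff (row i) j) t * u ^ j)"
        using S i by (simp add: scalar_prod_def S_idx atLeast0LessThan w_def)
      also have "\<dots> = ev2 (row i) t u"
        using ev2_altdef[OF deg_row[OF i]] by simp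
      also have "\<dots> = 0"
        using zero by (simp add: row_def ev2_mult)
      finally show "(map_mat (\<lambda>p. poly p t) S *\<^sub>v w) $ i = 0\<^sub>v n $ i"
        using i by simp
    qed (use S in auto)
    moreover have "w \<in> carrier_vec n" "w \<noteq> 0\<^sub>v n"
    proof -
      have "w $ 0 = 1"
        using n by (simp add: w_def)
      then show "w \<noteq> 0\<^sub>v n"
        using n by auto
    qed (simp add: w_def)
    ultimately have "det (map_mat (\<lambda>p. poly p t) S) = 0"
      using det_0_iff_vec_prod_zero_field[of "map_mat (\<lambda>p. poly p t) S" n] S by auto
    then show "poly (det S) t = 0"
      using poly_det[OF S] by simp
  qed
  then show "finite {t. \<exists>u. ev2 F t u = 0 \<and> ev2 G t u = 0}"
    using poly_roots_finite[OF det_nz] finite_subset by blast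
  have "card {t. \<exists>u. ev2 F t u = 0 \<and> ev2 G t u = 0} \<le> card {t. poly (det S) t = 0}"
    using poly_roots_finite[OF det_nz] sub by (rule card_mono)
  also have "\<dots> \<le> degree (det S)"
    using det_nz by (rule card_poly_roots_bound)
  finally show "card {t. \<exists>u. ev2 F t u = 0 \<and> ev2 G t u = 0} \<le> d1 * e2 + d2 * e1"
    using deg by simp
qed

section \<open>A lower bound of Chebyshev type\<close>

text \<open>The reciprocals \<open>a n k\<close> are the entries of the Leibniz harmonic triangle.
  Each entry in column \<open>Suc k\<close> is a difference of two entries in column
  \<open>k\<close>, so multiplying by the lcm keeps them integral by induction on
  \<open>k\<close>.\<close>

lemma binomial_dvd_Lcm:
  assumes "1 \<le> k" "k \<le> n"
  shows "k * (n choose k) dvd Lcm {1..n}"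
proof -
  define a :: "nat \<Rightarrow> nat \<Rightarrow> rat" where "a n k = 1 / of_nat (k * (n choose k))" for n k
  have step: "a n (Suc k) = a (n - 1) k - a n k" if "1 \<le> k" "k < n" for n k
  proof -
    have "Suc k * (n choose Suc k) = (n - k) * (n choose k)"
      using that binomial_absorb_comp[of n k] binomial_absorption[of k n] by simp
    moreover have "n * ((n - 1) choose k) = (n - k) * (n choose k)"
      using binomial_absorb_comp[of n k] by simp
    moreover have "n choose k > 0"
      using that by simp
    moreover have "(of_nat (n - k) :: rat) = of_nat n - of_nat k"
      using that by (simp add: of_nat_diff)
    moreover have "((n - 1) choose k) > 0"
      using that by simp
    ultimately have 1: "(of_nat (Suc k * (n choose Suc k)) :: rat) = (of_nat n - of_nat k) * of_nat (n choose k)"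
      and 2: "(of_nat n :: rat) * of_nat ((n - 1) choose k) = (of_nat n - of_nat k) * of_nat (n choose k)"
      and pos: "(of_nat (n choose k) :: rat) > 0" "(of_nat ((n - 1) choose k) :: rat) > 0"
      by (simp_all only: of_nat_mult[symmetric] of_nat_0_less_iff) (simp_all add: algebra_simps)
    have n: "(of_nat n :: rat) > of_nat k" "(of_nat k :: rat) > 0"
      using that by auto
    have aux: "1 / ((N - K) * A) = 1 / (K * B) - 1 / (K * A)"
      if "N * B = (N - K) * A" "N > K" "K > 0" "A > 0" for N K A B :: rat
    proof -
      have B: "B = (N - K) * A / N"
        using that by (simp add: field_simps)
      show ?thesis
        unfolding B using that by (simp add: field_simps)
    qed
    show ?thesis
      unfolding a_def 1 unfolding of_nat_mult by (rule aux) (use 2 n pos in auto)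
  qed
  have "of_nat (Lcm {1..n}) * a n k \<in> \<int>"
    using assms
  proof (induction k arbitrary: n rule: nat_induct_at_least)
    case base
    then have "n dvd Lcm {1..n}"
      by (intro dvd_Lcm) auto
    then obtain c where "Lcm {1..n} = n * c" ..
    then show ?case
      using base by (simp add: a_def)
  next
    case (Suc k)
    have "Lcm {1..n - 1} dvd Lcm {1..n}"
      by (intro Lcm_subset) auto
    then obtain c where c: "Lcm {1..n} = Lcm {1..n - 1} * c" ..
    have "of_nat (Lcm {1..n}) * a n (Suc k)
      = of_nat c * (of_nat (Lcm {1..n - 1}) * a (n - 1) k) - of_nat (Lcm {1..n}) * a n k"
      using step[of k n] Suc by (simp add: c right_diff_distrib del: One_nat_def)
    also have "\<dots> \<in> \<int>"
      using Suc by (intro Ints_diff Ints_mult Suc.IH) auto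
    finally show ?case .
  qed
  then obtain z where z: "of_nat (Lcm {1..n}) * a n k = of_int z"
    by (elim Ints_cases)
  have "k * (n choose k) > 0"
    using assms by simp
  then have "of_int (int (Lcm {1..n})) = (of_int (z * int (k * (n choose k))) :: rat)"
    using z by (simp add: a_def field_simps)
  then have "int (Lcm {1..n}) = z * int (k * (n choose k))"
    by (simp only: of_int_eq_iff)
  then show ?thesis
    by (metis dvd_triv_right int_dvd_int_iff)
qed

text \<open>The factor \<open>m\<close> in \<open>m * (2 * m choose m)\<close> cancels the loss in
  the central binomial bound \<open>4 ^ m / (2 * m)\<close>.\<close>

lemma power4_le_Lcm:
  assumes "m \<ge> 1"
  shows "4 ^ m \<le> 2 * real (Lcm {1..2 * m})"
proof -
  have "m * (2 * m choose m) \<le> Lcm {1..2 * m}"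
    using assms by (intro dvd_imp_le binomial_dvd_Lcm) (auto intro!: Nat.gr0I simp: Lcm_0_iff)
  then have "real m * real (2 * m choose m) \<le> real (Lcm {1..2 * m})"
    by (simp only: of_nat_mult[symmetric] of_nat_le_iff)
  moreover have "4 ^ m / (2 * real m) \<le> real (2 * m choose m)"
    using assms by (intro central_binomial_lower_bound) simp
  then have "4 ^ m \<le> 2 * (real m * real (2 * m choose m))"
    using assms by (simp add: field_simps)
  ultimately show ?thesis
    by linarith
qed

text \<open>The lcm divides the product of the maximal prime powers \<open>p ^ e p\<close> up to
  \<open>n\<close>. Such a power contributes just \<open>ln p\<close> when \<open>p ^ 2 > n\<close>,
  and at most \<open>ln n\<close> for the remaining primes, of which there are at most
  \<open>sqrt n\<close>.\<close>

lemma ln_Lcm_le: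
  assumes "n \<ge> 1"
  shows "ln (real (Lcm {1..n})) \<le> (\<Sum>p | prime p \<and> p \<le> n. ln (real p)) + sqrt (real n) * ln (real n)"
proof -
  define Ps where "Ps = {p. prime p \<and> p \<le> n}"
  define e where "e p = Max {k. p ^ k \<le> n}" for p
  define D where "D = (\<Prod>p\<in>Ps. p ^ e p)"
  have fin: "finite Ps"
    by (simp add: Ps_def)
  have fink: "finite {k. p ^ k \<le> n}" if "p \<ge> 2" for p
  proof (rule finite_subset)
    show "{k. p ^ k \<le> n} \<subseteq> {..n}"
    proof safe
      fix k assume "p ^ k \<le> n"
      moreover have "k < p ^ k"
        using that by (intro power_gt_expt) auto
      ultimately show "k \<le> n"
        by simp
    qed
  qed simp
  have e: "p ^ e p \<le> n" "\<And>k. p ^ k \<le> n \<Longrightarrow> k \<le> e p" if "p \<ge> 2" for p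
  proof -
    have "p ^ 0 \<le> n"
      using assms by simp
    then show "p ^ e p \<le> n"
      unfolding e_def using Max_in[OF fink[OF that]] by blast
    show "k \<le> e p" if "p ^ k \<le> n" for k
      using Max_ge[OF fink[OF \<open>p \<ge> 2\<close>]] that by (simp add: e_def)
  qed
  have D: "D > 0"
    by (auto simp: D_def Ps_def prime_gt_0_nat intro!: prod_pos)
  have "Lcm {1..n} dvd D"
  proof (rule Lcm_least)
    fix j assume j: "j \<in> {1..n}"
    show "j dvd D"
    proof (rule multiplicity_le_imp_dvd)
      fix p :: nat assume p: "prime p"
      show "multiplicity p j \<le> multiplicity p D"
      proof (cases "p \<in> Ps")
        case True
        have "p ^ multiplicity p j \<le> j"
          using j by (intro dvd_imp_le multiplicity_dvd) auto
        then have "multiplicity p j \<le> e p"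
          using j p by (intro e(2)) (auto dest: prime_ge_2_nat)
        also have "e p = multiplicity p D"
          unfolding D_def using fin p True
          by (subst multiplicity_prod_prime_powers) (auto simp: Ps_def)
        finally show ?thesis .
      next
        case False
        then have "\<not> p dvd j"
          using p j by (auto simp: Ps_def dest: dvd_imp_le)
        then show ?thesis
          by (simp add: not_dvd_imp_multiplicity_0)
      qed
    qed (use j in auto)
  qed
  then have "Lcm {1..n} \<le> D"
    using D by (rule dvd_imp_le)
  moreover have "Lcm {1..n} > 0"
    by (auto intro!: Nat.gr0I simp: Lcm_0_iff)
  ultimately have "ln (real (Lcm {1..n})) \<le> ln (real D)"
    by simp
  also have "\<dots> = (\<Sum>p\<in>Ps. real (e p) * ln (real p))"
    unfolding D_def of_nat_prod
    by (subst ln_prod) (auto simp: Ps_def prime_gt_0_nat ln_realpow fin)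
  also have "\<dots> \<le> (\<Sum>p\<in>Ps. ln (real p) + (if p ^ 2 \<le> n then ln (real n) else 0))"
  proof (rule sum_mono)
    fix p assume "p \<in> Ps"
    then have p: "p \<ge> 2" "p \<le> n"
      by (auto simp: Ps_def prime_ge_2_nat)
    show "real (e p) * ln (real p) \<le> ln (real p) + (if p ^ 2 \<le> n then ln (real n) else 0)"
    proof (cases "p ^ 2 \<le> n")
      case True
      have "real (e p) * ln (real p) = ln (real (p ^ e p))"
        using p by (simp add: ln_realpow)
      also have "\<dots> \<le> ln (real n)"
        using e(1)[OF p(1)] p by (subst ln_le_cancel_iff) (auto simp del: of_nat_power)
      finally have "real (e p) * ln (real p) \<le> ln (real n)" .
      moreover have "ln (real p) \<ge> 0"
        using p by simp
      ultimately show ?thesis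
        using True by simp
    next
      case False
      have "e p < 2"
      proof (rule ccontr)
        assume "\<not> e p < 2"
        then have "p ^ 2 \<le> p ^ e p"
          using p by (intro power_increasing) auto
        then show False
          using False e(1)[OF p(1)] by simp
      qed
      then have "real (e p) \<le> 1"
        by simp
      then have "real (e p) * ln (real p) \<le> 1 * ln (real p)"
        using p by (intro mult_right_mono) auto
      then show ?thesis
        using False by simp
    qed
  qed
  also have "\<dots> = (\<Sum>p\<in>Ps. ln (real p)) + real (card {p \<in> Ps. p ^ 2 \<le> n}) * ln (real n)"
    using fin by (simp add: sum.distrib sum.If_cases Int_def)
  also have "real (card {p \<in> Ps. p ^ 2 \<le> n}) \<le> sqrt (real n)"
  proof -
    have "{p \<in> Ps. p ^ 2 \<le> n} \<subseteq> {1..nat \<lfloor>sqrt (real n)\<rfloor>}"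
    proof safe
      fix p assume "p \<in> Ps" "p ^ 2 \<le> n"
      then have "real p \<le> sqrt (real n)"
        by (intro real_le_rsqrt) (simp flip: of_nat_power)
      then show "p \<in> {1..nat \<lfloor>sqrt (real n)\<rfloor>}"
        using \<open>p \<in> Ps\<close> prime_ge_1_nat by (auto simp: Ps_def le_nat_floor)
    qed
    then have "card {p \<in> Ps. p ^ 2 \<le> n} \<le> card {1..nat \<lfloor>sqrt (real n)\<rfloor>}"
      by (intro card_mono) auto
    then have "card {p \<in> Ps. p ^ 2 \<le> n} \<le> nat \<lfloor>sqrt (real n)\<rfloor>"
      by simp
    moreover have "real (nat \<lfloor>sqrt (real n)\<rfloor>) \<le> sqrt (real n)"
      by (intro of_nat_floor) simp
    ultimately show ?thesis
      by linarith
  qed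
  finally show ?thesis
    using assms by (simp add: Ps_def mult_right_mono)
qed

text \<open>Comparing the two bounds for the lcm of \<open>{1..2 * m}\<close> shows that the sum
  over the primes up to \<open>2 * m\<close> is at least \<open>m\<close> for large
  \<open>m\<close>.\<close>

theorem ex_primes_sum_ln_ge:
  "\<exists>c::real. c > 0 \<and> (\<forall>L\<ge>1. \<exists>n::nat. real n \<le> c * L \<and> 2 * L \<le> (\<Sum>p | prime p \<and> p \<le> n. ln (real p)))"
proof -
  have "eventually (\<lambda>m::nat. real m * ln 4 - ln 2 - sqrt (real (2 * m)) * ln (real (2 * m)) \<ge> real m) at_top"
  proof -
    have "eventually (\<lambda>m::nat. sqrt (2 * real m) * ln (2 * real m) + 1 \<le> real m / 10) at_top"
      by real_asymp
    then show ?thesis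
    proof eventually_elim
      case (elim m)
      \<comment> \<open>From \<open>exp 1 <= 3\<close> and \<open>3 ^ 5 = 243 <= 256 = 4 ^ 4\<close>
        follows \<open>ln 4 >= 5 / 4\<close>. The excess \<open>m / 4\<close> absorbs the error
        terms, which are at most \<open>m / 10\<close>.\<close>
      have "exp 5 = (exp 1 :: real) ^ 5"
        by (simp flip: exp_of_nat_mult)
      also have "\<dots> \<le> 3 ^ 5"
        by (intro power_mono exp_le) simp
      also have "\<dots> \<le> 4 ^ 4"
        by simp
      finally have "5 \<le> ln (4 ^ 4 :: real)"
        by (subst ln_ge_iff) auto
      then have "ln 4 \<ge> (5 / 4 :: real)"
        by (subst (asm) ln_realpow) auto
      then have "real m * ln 4 \<ge> real m * (5 / 4)"
        by (intro mult_left_mono) auto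
      with elim ln_2_less_1 show ?case
        by simp
    qed
  qed
  then obtain m0 where m0: "\<And>m. m \<ge> m0 \<Longrightarrow> real m * ln 4 - ln 2 - sqrt (real (2 * m)) * ln (real (2 * m)) \<ge> real m"
    by (auto simp: eventually_at_top_linorder)
  show ?thesis
  proof (intro exI[of _ "2 * (real m0 + 4)"] conjI allI impI)
    fix L :: real assume L: "L \<ge> 1"
    \<comment> \<open>The part \<open>m0\<close> makes the asymptotic estimate valid and the rest
      gives \<open>m >= 2 * L\<close>. Since \<open>L >= 1\<close>, the ceiling and
      \<open>m0\<close> are absorbed into the constant \<open>2 * (m0 + 4)\<close>.\<close>
    define m where "m = m0 + nat \<lceil>2 * L\<rceil>"
    have m: "m \<ge> 1" "real m \<ge> 2 * L" "m \<ge> m0"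
      using L unfolding m_def by linarith+
    have "real m \<le> real m0 + (2 * L + 1)"
      using L unfolding m_def by linarith
    also have "\<dots> \<le> real m0 * L + (2 * L + L)"
      using L mult_left_mono[of 1 L "real m0"] by simp
    also have "\<dots> \<le> (real m0 + 4) * L"
      using L by (simp add: algebra_simps)
    finally have "real (2 * m) \<le> 2 * (real m0 + 4) * L"
      by (simp add: algebra_simps)
    moreover have "real m * ln 4 \<le> ln 2 + ln (real (Lcm {1..2 * m}))"
    proof -
      have pos: "real (Lcm {1..2 * m}) > 0"
        by (auto intro!: Nat.gr0I simp: Lcm_0_iff)
      have "real m * ln 4 = ln (4 ^ m)"
        by (simp add: ln_realpow)
      also have "\<dots> \<le> ln (2 * real (Lcm {1..2 * m}))"
        using power4_le_Lcm[OF m(1)] pos by (subst ln_le_cancel_iff) auto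
      also have "\<dots> = ln 2 + ln (real (Lcm {1..2 * m}))"
        using pos by (simp add: ln_mult)
      finally show ?thesis .
    qed
    then have "2 * L \<le> (\<Sum>p | prime p \<and> p \<le> 2 * m. ln (real p))"
      using ln_Lcm_le[of "2 * m"] m0[OF m(3)] m by linarith
    ultimately show "\<exists>n::nat. real n \<le> 2 * (real m0 + 4) * L \<and> 2 * L \<le> (\<Sum>p | prime p \<and> p \<le> n. ln (real p))"
      by blast
  qed simp
qed

section \<open>Polynomial congruences\<close>

definition slice :: "'a::comm_ring_1 \<Rightarrow> 'a poly poly \<Rightarrow> 'a poly" where
  "slice t G = map_poly (\<lambda>c. poly c t) G"

lemma coeff_slice: "coeff (slice t G) l = poly (coeff G l) t"
  by (simp add: slice_def coeff_map_poly)

lemma degree_slice_le: "degree (slice t G) \<le> degree G"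
  unfolding slice_def by (rule map_poly_degree_leq)

lemma poly_slice: "poly (slice t G) u = ev2 G t u"
proof -
  have "poly (slice t G) u = (\<Sum>i<Suc (degree G). coeff (slice t G) i * u ^ i)"
    using poly_altdef_le[OF degree_slice_le] by (simp add: lessThan_Suc_atMost)
  also have "\<dots> = ev2 G t u"
    by (subst ev2_altdef[of G "Suc (degree G)"]) (simp_all add: coeff_slice)
  finally show ?thesis .
qed

lemma pderiv_slice: "pderiv (slice t G) = slice t (pderiv G)"
  by (rule poly_eqI) (simp add: coeff_pderiv coeff_slice)

text \<open>The remainder \<open>w\<close> stays in the ring, as a Newton step over the integers
  requires.\<close>

lemma poly_taylor2:
  fixes p :: "'a::idom poly"
  obtains w where "poly p (u + e) = poly p u + e * poly (pderiv p) u + e ^ 2 * w"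
proof (induction p arbitrary: thesis)
  case 0
  from 0[of 0] show ?case by simp
next
  case (pCons c p)
  obtain w where "poly p (u + e) = poly p u + e * poly (pderiv p) u + e ^ 2 * w"
    using pCons.IH .
  then show ?case
    by (intro pCons.prems[of "poly (pderiv p) u + (u + e) * w"])
       (simp add: pderiv_pCons algebra_simps power2_eq_square)
qed

lemma poly_cong:
  fixes p :: "int poly"
  assumes "[x = y] (mod m)"
  shows "[poly p x = poly p y] (mod m)"
  by (induction p) (auto intro!: cong_add cong_mult assms)

lemma ev2_cong:
  fixes G :: "int poly poly"
  assumes "[t = t'] (mod m)" "[u = u'] (mod m)"
  shows "[ev2 G t u = ev2 G t' u'] (mod m)"
proof -
  have "[ev2 G t u = ev2 G t' u] (mod m)"
    unfolding ev2_def using assms(1) by (rule poly_cong)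
  also have "[ev2 G t' u = ev2 G t' u'] (mod m)"
    unfolding poly_slice[symmetric] using assms(2) by (rule poly_cong)
  finally show ?thesis .
qed

lemma biev_cong:
  fixes G :: "int poly poly"
  assumes "[x2 = x2'] (mod m)" "[y2 = y2'] (mod m)"
  shows "[biev e1 e2 G x1 x2 y1 y2 = biev e1 e2 G x1 x2' y1 y2'] (mod m)"
  unfolding biev_def by (intro cong_sum cong_mult cong_refl cong_pow assms)

text \<open>Newton iteration for all \<open>t\<close> at once: the lift is a polynomial in
  \<open>t\<close>, and the fixed inverse \<open>c\<close> of the derivative modulo \<open>l\<close>
  gains one power of \<open>l\<close> per step. Only uniqueness is claimed: solutions in the class
  lie on the graph of \<open>h\<close>.\<close>

lemma hensel_poly:
  fixes G :: "int poly poly" and l t0 u0 :: int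
  assumes "coprime (ev2 (pderiv G) t0 u0) l"
  obtains h :: "int poly" where
    "\<And>t u. [t = t0] (mod l) \<Longrightarrow> [u = u0] (mod l) \<Longrightarrow> l ^ Suc m dvd ev2 G t u \<Longrightarrow> [u = poly h t] (mod l ^ Suc m)"
proof -
  obtain c where c: "[ev2 (pderiv G) t0 u0 * c = 1] (mod l)"
    using assms cong_solve_coprime_int by blast
  have "\<exists>h. \<forall>t u. [t = t0] (mod l) \<longrightarrow> [u = u0] (mod l) \<longrightarrow> l ^ Suc m dvd ev2 G t u \<longrightarrow> [u = poly h t] (mod l ^ Suc m)"
  proof (induction m)
    case 0
    show ?case
      by (intro exI[of _ "[:u0:]"]) simp
  next
    case (Suc m)
    then obtain h where h: "\<And>t u. [t = t0] (mod l) \<Longrightarrow> [u = u0] (mod l) \<Longrightarrow> l ^ Suc m dvd ev2 G t u \<Longrightarrow> [u = poly h t] (mod l ^ Suc m)"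
      by blast
    show ?case
    proof (intro exI[of _ "h - smult c (poly G h)"] allI impI)
      fix t u assume t: "[t = t0] (mod l)" and u: "[u = u0] (mod l)" and dvd: "l ^ Suc (Suc m) dvd ev2 G t u"
      define e where "e = u - poly h t"
      from dvd have "l ^ Suc m dvd ev2 G t u"
        by (rule dvd_trans[rotated]) (simp add: le_imp_power_dvd)
      then have e: "l ^ Suc m dvd e"
        unfolding e_def using h[OF t u] by (simp only: cong_iff_dvd_diff)
      obtain w where w: "ev2 G t (u + - e) = ev2 G t u + - e * ev2 (pderiv G) t u + (- e) ^ 2 * w"
        using poly_taylor2[of "slice t G" u "- e"] by (auto simp: pderiv_slice poly_slice)
      have ev: "poly (poly G h) t = ev2 G t (u + - e)"
      proof -
        have "poly (poly p h) t = ev2 p t (poly h t)" for p :: "int poly poly"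
          by (induction p) (simp_all add: ev2_def)
        then show ?thesis
          by (simp add: e_def)
      qed
      \<comment> \<open>In the first term \<open>e\<close> carries \<open>l ^ Suc m\<close> and the
        bracket one more \<open>l\<close>; the second carries \<open>l ^ (2 * Suc m)\<close>; the
        third is divisible by \<open>dvd\<close>.\<close>
      have eq: "u - poly (h - smult c (poly G h)) t
          = e * (1 - ev2 (pderiv G) t u * c) + e ^ 2 * (c * w) + ev2 G t u * c"
      proof -
        have "u - poly (h - smult c (poly G h)) t = e + c * ev2 G t (u + - e)"
          by (simp add: ev) (simp add: e_def)
        then show ?thesis
          unfolding w by (simp add: algebra_simps)
      qed
      have "[ev2 (pderiv G) t u * c = 1] (mod l)"
        using cong_mult[OF ev2_cong[OF t u] cong_refl] c by (rule cong_trans)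
      then have "l dvd 1 - ev2 (pderiv G) t u * c"
        by (metis cong_iff_dvd_diff cong_sym)
      then have "l ^ Suc m * l dvd e * (1 - ev2 (pderiv G) t u * c)"
        using e by (intro mult_dvd_mono)
      moreover have "l ^ Suc (Suc m) dvd e ^ 2"
      proof -
        have "l ^ Suc (Suc m) dvd l ^ (Suc m * 2)"
          by (intro le_imp_power_dvd) simp
        also have "\<dots> dvd e ^ 2"
          unfolding power_mult using e by (rule dvd_power_same)
        finally show ?thesis .
      qed
      ultimately have "l ^ Suc (Suc m) dvd u - poly (h - smult c (poly G h)) t"
        unfolding eq using dvd by (intro dvd_add) (simp_all add: mult_ac)
      then show "[u = poly (h - smult c (poly G h)) t] (mod l ^ Suc (Suc m))"
        by (simp only: cong_iff_dvd_diff)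
    qed
  qed
  then show ?thesis
    using that by blast
qed

section \<open>Roots of integer polynomials modulo a prime\<close>

lemma finite_Collect_residues: "finite {u \<in> {0..<l::int}. P u}"
  by (rule finite_subset[of _ "{0..<l}"]) auto

lemma card_insert_le_Suc: "card (insert a A) \<le> Suc (card A)"
  by (cases "finite A") (auto simp: card_insert_if)

text \<open>The factor theorem over the integers: dividing by \<open>X - a\<close> leaves the
  remainder \<open>poly q a\<close>, which \<open>l\<close> divides. The quotient is again nonzero
  modulo \<open>l\<close> and contains all roots other than \<open>a\<close>.\<close>

lemma card_roots_mod_prime:
  fixes l :: int
  assumes l: "prime l"
  shows "\<not> l dvd coeff q i \<Longrightarrow> card {u \<in> {0..<l}. l dvd poly q u} \<le> degree q"
proof (induction "degree q" arbitrary: q i rule: less_induct)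
  case less
  show ?case
  proof (cases "{u \<in> {0..<l}. l dvd poly q u} = {}")
    case True
    show ?thesis
      unfolding True by simp
  next
    case False
    then obtain a where a: "a \<in> {0..<l}" "l dvd poly q a"
      by auto
    define r where "r = synthetic_div q a"
    have q: "q = [:- a, 1:] * r + [:poly q a:]"
      using synthetic_div_correct'[of a q] by (simp add: r_def)
    have deg: "degree q > 0"
    proof (rule ccontr)
      assume "\<not> degree q > 0"
      then obtain c where "q = [:c:]"
        by (auto elim: degree_eq_zeroE)
      then show False
        using a less.prems by (cases i) auto
    qed
    have deg_r: "degree r = degree q - 1"
      by (simp add: r_def degree_synthetic_div)
    have "\<exists>i. \<not> l dvd coeff r i"
    proof (rule ccontr)
      assume "\<not> ?thesis"
      then have "l dvd coeff ([:- a, 1:] * r) i"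
        by (auto simp: coeff_pCons split: nat.splits intro!: dvd_add)
      moreover have "l dvd coeff [:poly q a:] i"
        using a by (cases i) auto
      ultimately have "l dvd coeff q i"
        by (subst q) (simp only: coeff_add dvd_add)
      with less.prems show False ..
    qed
    then have IH: "card {u \<in> {0..<l}. l dvd poly r u} \<le> degree q - 1"
      using less.hyps[of r] deg deg_r by auto
    have "{u \<in> {0..<l}. l dvd poly q u} \<subseteq> insert a {u \<in> {0..<l}. l dvd poly r u}"
    proof (rule subsetI)
      fix u assume "u \<in> {u \<in> {0..<l}. l dvd poly q u}"
      then have u: "u \<in> {0..<l}" "l dvd poly q u"
        by auto
      have "poly q u = (u - a) * poly r u + poly q a"
        by (subst q) (simp add: algebra_simps)
      then have "l dvd (u - a) * poly r u"
        using u(2) a(2) by (simp add: dvd_add_left_iff)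
      then consider "l dvd u - a" | "l dvd poly r u"
        using l by (auto simp: prime_dvd_mult_iff)
      then show "u \<in> insert a {u \<in> {0..<l}. l dvd poly r u}"
      proof cases
        case 1
        then have "[u = a] (mod l)"
          by (simp add: cong_iff_dvd_diff)
        then have "u = a"
          using u a by (intro cong_less_imp_eq_int[of u l a]) auto
        then show ?thesis
          by simp
      qed (use u in auto)
    qed
    then have "card {u \<in> {0..<l}. l dvd poly q u} \<le> card (insert a {u \<in> {0..<l}. l dvd poly r u})"
      by (intro card_mono finite.insertI finite_Collect_residues)
    also have "\<dots> \<le> Suc (card {u \<in> {0..<l}. l dvd poly r u})"
      by (rule card_insert_le_Suc)
    finally show ?thesis
      using IH deg by simp
  qed
qed

text \<open>If all coefficients of \<open>q\<close> vanish modulo \<open>l\<close>, so does its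
  derivative, and no root is simple. Slices that vanish identically modulo \<open>l\<close> are
  therefore harmless.\<close>

lemma card_simple_roots_mod_prime:
  fixes l :: int
  assumes l: "prime l"
  shows "card {u \<in> {0..<l}. l dvd poly q u \<and> \<not> l dvd poly (pderiv q) u} \<le> degree q"
proof (cases "\<exists>i. \<not> l dvd coeff q i")
  case True
  then obtain i where "\<not> l dvd coeff q i" ..
  have "card {u \<in> {0..<l}. l dvd poly q u \<and> \<not> l dvd poly (pderiv q) u} \<le> card {u \<in> {0..<l}. l dvd poly q u}"
    by (intro card_mono finite_Collect_residues) auto
  with card_roots_mod_prime[OF l \<open>\<not> l dvd coeff q i\<close>] show ?thesis
    by simp
next
  case False
  then have "l dvd poly (pderiv q) u" for u
    unfolding poly_altdef by (intro dvd_sum) (simp add: coeff_pderiv)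
  then show ?thesis
    by simp
qed

text \<open>Two coefficient vectors in a box share their image under \<open>\<Phi>\<close>; for
  additive conditions their difference is the wanted small solution.\<close>

lemma pigeonhole_coeffs:
  fixes \<Phi> :: "('i \<Rightarrow> int) \<Rightarrow> 'v" and A :: nat
  assumes "finite J" "finite V" "card V < (A + 1) ^ card J"
    and "\<And>c. \<forall>j\<in>J. 0 \<le> c j \<and> c j \<le> int A \<Longrightarrow> \<Phi> c \<in> V"
  shows "\<exists>c c'. (\<forall>j\<in>J. \<bar>c j - c' j\<bar> \<le> int A) \<and> \<Phi> c = \<Phi> c' \<and> (\<exists>j\<in>J. c j \<noteq> c' j)"
proof -
  let ?E = "J \<rightarrow>\<^sub>E {0..int A}"
  have "\<Phi> ` ?E \<subseteq> V"
    using assms(4) by (auto simp: PiE_iff)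
  moreover have "card ?E = (A + 1) ^ card J"
    using assms(1) by (simp add: card_PiE nat_add_distrib)
  ultimately have "card (\<Phi> ` ?E) < card ?E"
    using card_mono[OF assms(2), of "\<Phi> ` ?E"] assms(3) by linarith
  then have "\<not> inj_on \<Phi> ?E"
    by (rule pigeonhole)
  then obtain c c' where c: "c \<in> ?E" "c' \<in> ?E" "\<Phi> c = \<Phi> c'" "c \<noteq> c'"
    by (auto simp: inj_on_def)
  have "\<exists>j\<in>J. c j \<noteq> c' j"
    using c by (meson PiE_ext)
  moreover have "\<bar>c j - c' j\<bar> \<le> int A" if "j \<in> J" for j
  proof -
    have "0 \<le> c j \<and> c j \<le> int A" "0 \<le> c' j \<and> c' j \<le> int A"
      using c that by (auto simp: PiE_iff)
    then show ?thesis by linarith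
  qed
  ultimately show ?thesis
    using c(3) by blast
qed

section \<open>Auxiliary polynomials from the pigeonhole principle\<close>

lemma bipoly_diff: "bipoly e1 e2 (\<lambda>i. c i - c' i) = bipoly e1 e2 c - bipoly e1 e2 c'"
  by (intro poly_eqI) (simp add: coeff_bipoly)

lemma bipoly_nonzero: "j \<le> e1 \<Longrightarrow> l \<le> e2 \<Longrightarrow> c (j, l) \<noteq> 0 \<Longrightarrow> bipoly e1 e2 c \<noteq> 0"
  by (metis coeff_0 coeff_bipoly)

lemma biev_diff: "biev e1 e2 (G - H) x1 x2 y1 y2 = biev e1 e2 G x1 x2 y1 y2 - biev e1 e2 H x1 x2 y1 y2"
  by (simp add: biev_def sum_subtractf algebra_simps)

lemma abs_biev_le:
  fixes G :: "int poly poly"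
  assumes G: "\<And>l j. \<bar>coeff (coeff G l) j\<bar> \<le> A"
    and x: "\<bar>x1\<bar> \<le> B1" "\<bar>x2\<bar> \<le> B1" and y: "\<bar>y1\<bar> \<le> B2" "\<bar>y2\<bar> \<le> B2"
  shows "\<bar>biev e1 e2 G x1 x2 y1 y2\<bar> \<le> int ((e1 + 1) * (e2 + 1)) * (A * (B1 ^ e1 * B2 ^ e2))"
proof -
  have mon: "\<bar>a ^ (e - i) * b ^ i\<bar> \<le> B ^ e" if "\<bar>a\<bar> \<le> B" "\<bar>b\<bar> \<le> B" "i \<le> e" for a b B :: int and e i
  proof -
    have "\<bar>a ^ (e - i) * b ^ i\<bar> \<le> B ^ (e - i) * B ^ i"
      unfolding abs_mult power_abs using that by (intro mult_mono power_mono) auto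
    also have "\<dots> = B ^ e"
      using that by (simp flip: power_add)
    finally show ?thesis .
  qed
  have "A \<ge> 0"
    using G[of 0 0] by linarith
  have "\<bar>biev e1 e2 G x1 x2 y1 y2\<bar> \<le> (\<Sum>l\<le>e2. \<Sum>j\<le>e1. A * (B1 ^ e1 * B2 ^ e2))"
    unfolding biev_def
  proof (rule order_trans[OF sum_abs] sum_mono)+
    fix l j assume "l \<in> {..e2}" "j \<in> {..e1}"
    then have "\<bar>coeff (coeff G l) j * (x1 ^ (e1 - j) * x2 ^ j * (y1 ^ (e2 - l) * y2 ^ l))\<bar> \<le> A * (B1 ^ e1 * B2 ^ e2)"
      unfolding abs_mult[of "coeff _ _"] abs_mult[of "x1 ^ _ * _"] using \<open>A \<ge> 0\<close> x y
      by (intro mult_mono G mon) (auto intro!: mult_nonneg_nonneg zero_le_power)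
    then show "\<bar>coeff (coeff G l) j * (x1 ^ (e1 - j) * x2 ^ j) * (y1 ^ (e2 - l) * y2 ^ l)\<bar> \<le> A * (B1 ^ e1 * B2 ^ e2)"
      by (simp only: mult.assoc)
  qed
  then show ?thesis
    by (simp add: algebra_simps)
qed

lemma poly_ev_curve: "poly (poly G h) t = ev2 G t (poly h t)"
  by (induction G) (simp_all add: ev2_def)

lemma poly_pcompose_shift:
  fixes a t :: "'a::comm_ring_1"
  shows "poly (pcompose p [:a, 1:]) (t - a) = poly p t"
  by (simp add: poly_pcompose)

text \<open>Vanishing on a residue class costs \<open>s - k\<close> powers of \<open>q\<close> for the \<open>k\<close>-th Taylor
  coefficient along the curve, and \<open>s\<close> unknown coefficients are available.\<close>

lemma ex_small_poly_on_residue_class: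
  fixes h :: "int poly" and t0 :: int and M D q X1 X2 :: nat
  defines "s \<equiv> (M + 1) * (D + 1)"
  assumes q: "q \<ge> 1" and size: "s\<^sup>2 * X1 ^ (2 * M) * X2 ^ (2 * D) < q ^ (s - 1)"
  obtains G :: "int poly poly" where "G \<noteq> 0" "bideg_le M D G"
    "\<And>x1 x2 y1 y2 t u. \<bar>x1\<bar> \<le> int X1 \<Longrightarrow> \<bar>x2\<bar> \<le> int X1 \<Longrightarrow> \<bar>y1\<bar> \<le> int X2 \<Longrightarrow> \<bar>y2\<bar> \<le> int X2 \<Longrightarrow>
       [x2 = t * x1] (mod int q ^ s) \<Longrightarrow> [y2 = u * y1] (mod int q ^ s) \<Longrightarrow>
       [t = t0] (mod int q) \<Longrightarrow> [u = poly h t] (mod int q ^ s) \<Longrightarrow> biev M D G x1 x2 y1 y2 = 0"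
proof -
  have s: "s \<ge> 1"
    by (simp add: s_def)
  \<comment> \<open>Since \<open>(A + 1) ^ 2 > q ^ (s + 1)\<close>, the box has more than
    \<open>q ^ (s * (s + 1) / 2)\<close> elements, which is the number of residue vectors in
    \<open>V\<close>. The comparison is made on squares to avoid the halved exponent.\<close>
  define A where "A = floor_sqrt (q ^ (s + 1))"
  have A: "A ^ 2 \<le> q ^ (s + 1)" "q ^ (s + 1) < (A + 1) ^ 2"
    using Suc_floor_sqrt_power2_gt[of "q ^ (s + 1)"] floor_sqrt_power2_le[of "q ^ (s + 1)"]
    by (simp_all add: A_def)
  define J where "J = {..M} \<times> {..D}"
  have J: "finite J" "card J = s"
    by (simp_all add: J_def s_def)
  define V where "V = PiE {..<s} (\<lambda>k. {0..<int q ^ (s - k)})"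
  \<comment> \<open>The expansion of \<open>G(t, h(t))\<close> in powers of
    \<open>t - t0\<close>.\<close>
  define W where "W G = pcompose (poly G h) [:t0, 1:]" for G
  define \<Phi> where "\<Phi> c = restrict (\<lambda>k. coeff (W (bipoly M D c)) k mod int q ^ (s - k)) {..<s}" for c
  have sum_gauss: "2 * (\<Sum>k<s. s - k) = s * (s + 1)"
  proof -
    have "(\<Sum>k<s. s - k) = (\<Sum>k<s. Suc k)"
      using sum.nat_diff_reindex[of Suc s] by (simp add: Suc_diff_Suc)
    also have "2 * \<dots> = s * (s + 1)"
      by (induction s) auto
    finally show ?thesis .
  qed
  have card_V: "card V = q ^ (\<Sum>k<s. s - k)"
    by (simp add: V_def card_PiE power_sum flip: of_nat_power)
  have "card V < (A + 1) ^ card J"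
  proof (rule power_less_imp_less_base)
    have "card V ^ 2 = (q ^ (s + 1)) ^ s"
      by (simp only: card_V power_mult[symmetric] mult.commute[of _ 2] sum_gauss) (simp only: mult.commute)
    also have "\<dots> < ((A + 1) ^ 2) ^ s"
      using A(2) s by (intro power_strict_mono) auto
    also have "\<dots> = ((A + 1) ^ card J) ^ 2"
      by (simp only: J power_mult[symmetric] mult.commute)
    finally show "card V ^ 2 < ((A + 1) ^ card J) ^ 2" .
  qed simp
  moreover have "finite V"
    by (auto simp: V_def intro!: finite_PiE)
  moreover have "\<Phi> c \<in> V" for c
    using q by (auto simp: \<Phi>_def V_def)
  ultimately have "\<exists>c c'. (\<forall>j\<in>J. \<bar>c j - c' j\<bar> \<le> int A) \<and> \<Phi> c = \<Phi> c' \<and> (\<exists>j\<in>J. c j \<noteq> c' j)"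
    by (intro pigeonhole_coeffs[OF J(1)])
  then obtain c c' where c: "\<And>j. j \<in> J \<Longrightarrow> \<bar>c j - c' j\<bar> \<le> int A" "\<Phi> c = \<Phi> c'" "\<exists>j\<in>J. c j \<noteq> c' j"
    by blast
  define G where "G = bipoly M D (\<lambda>i. c i - c' i)"
  have "G \<noteq> 0"
  proof -
    obtain j l where "j \<le> M" "l \<le> D" "c (j, l) \<noteq> c' (j, l)"
      using c(3) by (auto simp: J_def)
    then show ?thesis
      unfolding G_def by (intro bipoly_nonzero[of j M l D]) simp_all
  qed
  moreover have G: "bideg_le M D G"
    by (simp add: G_def bideg_le_bipoly)
  moreover have "biev M D G x1 x2 y1 y2 = 0"
    if x: "\<bar>x1\<bar> \<le> int X1" "\<bar>x2\<bar> \<le> int X1" and y: "\<bar>y1\<bar> \<le> int X2" "\<bar>y2\<bar> \<le> int X2"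
      and t: "[x2 = t * x1] (mod int q ^ s)" and u: "[y2 = u * y1] (mod int q ^ s)"
      and t0: "[t = t0] (mod int q)" and h: "[u = poly h t] (mod int q ^ s)" for x1 x2 y1 y2 t u
  proof -
    \<comment> \<open>The power of \<open>t - t0\<close> supplies \<open>q ^ k\<close> and the
      coefficient the missing \<open>q ^ (s - k)\<close>; for \<open>k >= s\<close> the power alone
      suffices.\<close>
    have "int q ^ s dvd coeff (W G) k * (t - t0) ^ k" for k
    proof (cases "k < s")
      case True
      have "coeff (W (bipoly M D c)) k mod int q ^ (s - k) = coeff (W (bipoly M D c')) k mod int q ^ (s - k)"
        using fun_cong[OF c(2), of k] True by (simp add: \<Phi>_def)
      then have "int q ^ (s - k) dvd coeff (W (bipoly M D c)) k - coeff (W (bipoly M D c')) k"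
        by (simp add: mod_eq_dvd_iff)
      then have "int q ^ (s - k) dvd coeff (W G) k"
        by (simp add: W_def G_def bipoly_diff pcompose_diff)
      moreover have "int q ^ k dvd (t - t0) ^ k"
        using t0 by (intro dvd_power_same) (simp add: cong_iff_dvd_diff)
      ultimately have "int q ^ (s - k) * int q ^ k dvd coeff (W G) k * (t - t0) ^ k"
        by (rule mult_dvd_mono)
      then show ?thesis
        using True by (simp flip: power_add)
    next
      case False
      then have "int q ^ s dvd int q ^ k"
        by (intro le_imp_power_dvd) simp
      also have "\<dots> dvd (t - t0) ^ k"
        using t0 by (intro dvd_power_same) (simp add: cong_iff_dvd_diff)
      finally show ?thesis
        by simp
    qed
    then have "int q ^ s dvd poly (W G) (t - t0)"
      unfolding poly_altdef by (intro dvd_sum)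
    then have ev0: "[ev2 G t (poly h t) = 0] (mod int q ^ s)"
      by (simp add: W_def poly_pcompose_shift poly_ev_curve cong_0_iff)
    have "[biev M D G x1 x2 y1 y2 = x1 ^ M * y1 ^ D * ev2 G t u] (mod int q ^ s)"
      using biev_cong[OF t u, of M D G x1 y1] by (simp only: biev_scale[OF G])
    also have "[x1 ^ M * y1 ^ D * ev2 G t u = x1 ^ M * y1 ^ D * 0] (mod int q ^ s)"
      using cong_trans[OF ev2_cong[OF cong_refl h] ev0] by (intro cong_mult cong_refl)
    finally have dvd: "int q ^ s dvd biev M D G x1 x2 y1 y2"
      by (simp add: cong_0_iff)
    \<comment> \<open>An integer divisible by \<open>q ^ s\<close> and smaller in absolute value is
      zero. On squares, \<open>A ^ 2 <= q ^ (s + 1)\<close> combines with the bound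
      \<open>q ^ (s - 1)\<close> from \<open>size\<close>.\<close>
    have "\<bar>biev M D G x1 x2 y1 y2\<bar> \<le> int s * (int A * (int X1 ^ M * int X2 ^ D))"
      unfolding s_def
    proof (rule abs_biev_le[OF _ x y])
      show "\<bar>coeff (coeff G l) j\<bar> \<le> int A" for l j
        using c(1)[of "(j, l)"] by (simp add: G_def coeff_bipoly J_def)
    qed
    also have "\<dots> = int (s * (A * (X1 ^ M * X2 ^ D)))"
      by simp
    also have "\<dots> < int (q ^ s)"
    proof -
      have "(s * (A * (X1 ^ M * X2 ^ D))) ^ 2 = A ^ 2 * (s\<^sup>2 * X1 ^ (2 * M) * X2 ^ (2 * D))"
        by (simp add: power_mult_distrib mult_ac flip: power_mult)
      also have "\<dots> \<le> q ^ (s + 1) * (s\<^sup>2 * X1 ^ (2 * M) * X2 ^ (2 * D))"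
        using A by (intro mult_right_mono) auto
      also have "\<dots> < q ^ (s + 1) * q ^ (s - 1)"
        using size q by (intro mult_strict_left_mono) auto
      also have "\<dots> = (q ^ s) ^ 2"
      proof -
        have "s + 1 + (s - 1) = s * 2"
          using s by simp
        then show ?thesis
          by (simp only: power_add[symmetric] power_mult[symmetric])
      qed
      finally have "s * (A * (X1 ^ M * X2 ^ D)) < q ^ s"
        by (rule power_less_imp_less_base) simp
      then show ?thesis
        by (simp only: of_nat_less_iff)
    qed
    finally show ?thesis
      using dvd by (metis abs_of_nat dvd_imp_le_int linorder_not_less of_nat_power)
  qed
  ultimately show ?thesis
    by (rule that)
qed

text \<open>Siegel's lemma with \<open>n\<close> unknowns and \<open>card T\<close> equations: the
  height is a power of \<open>2 * n * (X1 ^ e1 * X2 ^ e2)\<close> whose exponent is at least the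
  ratio of \<open>card T\<close> to \<open>n - card T\<close>, here bounded by 6.\<close>

lemma ex_small_poly_through_points:
  fixes T :: "((int \<times> int) \<times> (int \<times> int)) set" and e1 e2 X1 X2 :: nat
  defines "n \<equiv> (e1 + 1) * (e2 + 1)"
  defines "A \<equiv> (2 * n * (X1 ^ e1 * X2 ^ e2)) ^ 6"
  assumes T: "finite T" "card T < n" "card T \<le> 6 * (n - card T)" and X: "X1 \<ge> 1" "X2 \<ge> 1"
    and box: "\<And>x1 x2 y1 y2. ((x1, x2), (y1, y2)) \<in> T \<Longrightarrow>
      \<bar>x1\<bar> \<le> int X1 \<and> \<bar>x2\<bar> \<le> int X1 \<and> \<bar>y1\<bar> \<le> int X2 \<and> \<bar>y2\<bar> \<le> int X2"
  obtains G :: "int poly poly" where "G \<noteq> 0" "bideg_le e1 e2 G"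
    "\<And>l j. \<bar>coeff (coeff G l) j\<bar> \<le> int A"
    "\<And>x1 x2 y1 y2. ((x1, x2), (y1, y2)) \<in> T \<Longrightarrow> biev e1 e2 G x1 x2 y1 y2 = 0"
proof -
  define H where "H = X1 ^ e1 * X2 ^ e2"
  have "n \<ge> 1" "H \<ge> 1"
    using X by (simp_all add: n_def H_def)
  define J where "J = {..e1} \<times> {..e2}"
  have J: "finite J" "card J = n"
    by (simp_all add: J_def n_def)
  define R where "R = {- int (n * (A * H))..int (n * (A * H))}"
  define V where "V = PiE T (\<lambda>_. R)"
  define \<Phi> where "\<Phi> c = restrict (\<lambda>((x1, x2), (y1, y2)). biev e1 e2 (bipoly e1 e2 c) x1 x2 y1 y2) T" for c
  have "card R = 2 * (n * (A * H)) + 1"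
    by (simp add: R_def nat_add_distrib nat_mult_distrib)
  then have card_V: "card V = (2 * (n * (A * H)) + 1) ^ card T"
    using T(1) by (simp add: V_def card_PiE)
  have "card V < (A + 1) ^ card J"
  proof -
    \<comment> \<open>Each equation consumes one factor \<open>A + 1\<close> of the box size; the
      other \<open>n - card T\<close> factors must outweigh the powers of
      \<open>2 * n * H\<close>.\<close>
    have "2 * (n * (A * H)) + 1 \<le> 2 * n * H * (A + 1)"
      using \<open>n \<ge> 1\<close> \<open>H \<ge> 1\<close> by (simp add: algebra_simps)
    then have "card V \<le> (2 * n * H * (A + 1)) ^ card T"
      unfolding card_V by (rule power_mono) simp
    also have "\<dots> = (2 * n * H) ^ card T * (A + 1) ^ card T"
      by (rule power_mult_distrib)
    also have "\<dots> \<le> (2 * n * H) ^ (6 * (n - card T)) * (A + 1) ^ card T"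
      using T(3) \<open>n \<ge> 1\<close> \<open>H \<ge> 1\<close> by (intro mult_right_mono power_increasing) auto
    also have "\<dots> = A ^ (n - card T) * (A + 1) ^ card T"
      by (simp only: A_def H_def power_mult)
    also have "\<dots> < (A + 1) ^ (n - card T) * (A + 1) ^ card T"
      using T(2) by (intro mult_strict_right_mono power_strict_mono) auto
    also have "\<dots> = (A + 1) ^ card J"
      using T(2) J by (simp flip: power_add)
    finally show ?thesis .
  qed
  moreover have "finite V"
    using T(1) by (auto simp: V_def R_def intro!: finite_PiE)
  moreover have "\<Phi> c \<in> V" if c: "\<forall>j\<in>J. 0 \<le> c j \<and> c j \<le> int A" for c
  proof -
    have "biev e1 e2 (bipoly e1 e2 c) x1 x2 y1 y2 \<in> R" if "((x1, x2), (y1, y2)) \<in> T" for x1 x2 y1 y2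
    proof -
      have "\<bar>biev e1 e2 (bipoly e1 e2 c) x1 x2 y1 y2\<bar> \<le> int ((e1 + 1) * (e2 + 1)) * (int A * (int X1 ^ e1 * int X2 ^ e2))"
      proof (rule abs_biev_le)
        show "\<bar>coeff (coeff (bipoly e1 e2 c) l) j\<bar> \<le> int A" for l j
          using bspec[OF c, of "(j, l)"] by (auto simp: coeff_bipoly J_def)
      qed (use box[OF that] in auto)
      also have "\<dots> = int (n * (A * H))"
        by (simp only: n_def H_def of_nat_mult of_nat_power)
      finally show ?thesis
        unfolding R_def atLeastAtMost_iff abs_le_iff by linarith
    qed
    then show ?thesis
      by (auto simp: \<Phi>_def V_def)
  qed
  ultimately have "\<exists>c c'. (\<forall>j\<in>J. \<bar>c j - c' j\<bar> \<le> int A) \<and> \<Phi> c = \<Phi> c' \<and> (\<exists>j\<in>J. c j \<noteq> c' j)"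
    by (intro pigeonhole_coeffs[OF J(1)])
  then obtain c c' where c: "\<And>j. j \<in> J \<Longrightarrow> \<bar>c j - c' j\<bar> \<le> int A" "\<Phi> c = \<Phi> c'" "\<exists>j\<in>J. c j \<noteq> c' j"
    by blast
  define G where "G = bipoly e1 e2 (\<lambda>i. c i - c' i)"
  show ?thesis
  proof (rule that[of G])
    obtain j l where "j \<le> e1" "l \<le> e2" "c (j, l) \<noteq> c' (j, l)"
      using c(3) by (auto simp: J_def)
    then show "G \<noteq> 0"
      unfolding G_def by (intro bipoly_nonzero[of j e1 l e2]) simp_all
    show "bideg_le e1 e2 G"
      by (simp add: G_def bideg_le_bipoly)
    show "\<bar>coeff (coeff G l) j\<bar> \<le> int A" for l j
      using c(1)[of "(j, l)"] by (simp add: G_def coeff_bipoly J_def)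
    show "biev e1 e2 G x1 x2 y1 y2 = 0" if "((x1, x2), (y1, y2)) \<in> T" for x1 x2 y1 y2
      using fun_cong[OF c(2), of "((x1, x2), (y1, y2))"] that
      by (simp add: \<Phi>_def G_def bipoly_diff biev_diff)
  qed
qed

section \<open>Choice of a prime that divides few of the given values\<close>

lemma sum_ln_prime_divisors_le:
  fixes N :: int
  assumes "N \<noteq> 0" "finite Ps" "\<And>p. p \<in> Ps \<Longrightarrow> prime p"
  shows "(\<Sum>p | p \<in> Ps \<and> int p dvd N. ln (real p)) \<le> ln \<bar>real_of_int N\<bar>"
proof -
  let ?Q = "{p \<in> Ps. int p dvd N}"
  have "int (\<Prod>?Q) dvd N"
    using assms(2,3)
  proof (induction Ps)
    case empty
    then show ?case by simp
  next
    case (insert p Ps)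
    have eq: "{q \<in> insert p Ps. int q dvd N} = (if int p dvd N then insert p {q \<in> Ps. int q dvd N} else {q \<in> Ps. int q dvd N})"
      by auto
    have "coprime p (\<Prod>{q \<in> Ps. int q dvd N})"
    proof (rule prod_coprime_right)
      fix q assume "q \<in> {q \<in> Ps. int q dvd N}"
      then show "coprime p q"
        using insert by (intro primes_coprime) auto
    qed
    then have "coprime (int p) (int (\<Prod>{q \<in> Ps. int q dvd N}))"
      by (simp only: coprime_int_iff)
    moreover have "int (\<Prod>{q \<in> Ps. int q dvd N}) dvd N"
      using insert by simp
    ultimately have "int p dvd N \<Longrightarrow> int p * int (\<Prod>{q \<in> Ps. int q dvd N}) dvd N"
      by (intro divides_mult)
    then show ?case
      using insert.hyps \<open>int (\<Prod>{q \<in> Ps. int q dvd N}) dvd N\<close> unfolding eq by simp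
  qed
  then have "\<bar>int (\<Prod>?Q)\<bar> \<le> \<bar>N\<bar>"
    using assms(1) by (rule dvd_imp_le_int[rotated])
  then have "real (\<Prod>?Q) \<le> \<bar>real_of_int N\<bar>"
    by linarith
  moreover have "real (\<Prod>?Q) > 0"
    using assms by (auto intro!: prod_pos simp: prime_gt_0_nat)
  ultimately have "ln (real (\<Prod>?Q)) \<le> ln \<bar>real_of_int N\<bar>"
    by (subst ln_le_cancel_iff) (use assms(1) in auto)
  also have "ln (real (\<Prod>?Q)) = (\<Sum>p\<in>?Q. ln (real p))"
    unfolding of_nat_prod using assms by (subst ln_prod) (auto simp: prime_gt_0_nat)
  finally show ?thesis .
qed

text \<open>Double counting weighted by \<open>ln p\<close>. Each point excludes primes of total
  weight at most \<open>L\<close>; if every prime in \<open>Ps\<close> divided more than half of the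
  values, the average excluded weight would be above \<open>L\<close>.\<close>

lemma ex_prime_good_for_half:
  fixes N :: "'a \<Rightarrow> int"
  assumes S: "finite S" and N: "\<And>P. P \<in> S \<Longrightarrow> N P \<noteq> 0 \<and> ln \<bar>real_of_int (N P)\<bar> \<le> L"
    and L: "L > 0" and Ps: "finite Ps" "\<And>p. p \<in> Ps \<Longrightarrow> prime p" "2 * L \<le> (\<Sum>p\<in>Ps. ln (real p))"
  shows "\<exists>p\<in>Ps. card S \<le> 2 * card {P \<in> S. \<not> int p dvd N P}"
proof (rule ccontr)
  assume "\<not> ?thesis"
  then have neg: "2 * card {P \<in> S. \<not> int p dvd N P} < card S" if "p \<in> Ps" for p
    using that by (meson not_less)
  have bad: "card S < 2 * card {P \<in> S. int p dvd N P}" if "p \<in> Ps" for p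
  proof -
    have "card {P \<in> S. \<not> int p dvd N P} + card {P \<in> S. int p dvd N P} = card S"
      using S by (subst card_Un_disjoint[symmetric]) (auto intro!: arg_cong[of _ _ card])
    then show ?thesis
      using neg[OF that] by linarith
  qed
  have "Ps \<noteq> {}"
    using Ps(3) L by auto
  have "real (card S) * (2 * L) \<le> real (card S) * (\<Sum>p\<in>Ps. ln (real p))"
    using Ps(3) by (intro mult_left_mono) auto
  also have "\<dots> = (\<Sum>p\<in>Ps. real (card S) * ln (real p))"
    by (rule sum_distrib_left)
  also have "\<dots> < (\<Sum>p\<in>Ps. real (2 * card {P \<in> S. int p dvd N P}) * ln (real p))"
  proof (intro sum_strict_mono mult_strict_right_mono)
    show "ln (real p) > 0" if "p \<in> Ps" for p
      using Ps(2)[OF that] prime_gt_1_nat[of p] by simp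
  qed (use Ps bad \<open>Ps \<noteq> {}\<close> in \<open>auto simp only: of_nat_less_iff\<close>)
  also have "\<dots> = 2 * (\<Sum>p\<in>Ps. \<Sum>P\<in>S. if int p dvd N P then ln (real p) else 0)"
    using S by (simp add: sum_distrib_left sum.If_cases Int_def mult_ac)
  also have "\<dots> = 2 * (\<Sum>P\<in>S. \<Sum>p\<in>Ps. if int p dvd N P then ln (real p) else 0)"
    by (subst sum.swap) simp
  also have "\<dots> = 2 * (\<Sum>P\<in>S. \<Sum>p | p \<in> Ps \<and> int p dvd N P. ln (real p))"
    using Ps(1) by (simp add: sum.If_cases Int_def)
  also have "\<dots> \<le> 2 * (\<Sum>P\<in>S. L)"
    using N Ps by (intro mult_left_mono sum_mono order_trans[OF sum_ln_prime_divisors_le]) auto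
  also have "\<dots> = real (card S) * (2 * L)"
    by simp
  finally show False
    by simp
qed

section \<open>Rational points in residue classes\<close>

text \<open>This chart omits only the representative \<open>(0, 1)\<close>, whose contribution is
  counted separately at the end.\<close>

definition affine :: "int \<times> int \<Rightarrow> bool" where
  "affine x \<longleftrightarrow> P1_rep x \<and> fst x > 0"

definition slope :: "int \<times> int \<Rightarrow> rat" where
  "slope x = of_int (snd x) / of_int (fst x)"

abbreviation rat2 :: "int poly poly \<Rightarrow> rat poly poly" where
  "rat2 G \<equiv> map_poly (map_poly rat_of_int) G"

definition bev :: "nat \<Rightarrow> nat \<Rightarrow> int poly poly \<Rightarrow> (int \<times> int) \<times> (int \<times> int) \<Rightarrow> int" where
  "bev e1 e2 G P = biev e1 e2 G (fst (fst P)) (snd (fst P)) (fst (snd P)) (snd (snd P))"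

lemma slope_inj: "inj_on slope {x. affine x}"
proof (rule inj_onI)
  fix x y assume x: "x \<in> {x. affine x}" and y: "y \<in> {x. affine x}" and eq: "slope x = slope y"
  have pos: "fst x > 0" "fst y > 0" and cop: "coprime (fst x) (snd x)" "coprime (fst y) (snd y)"
    using x y by (auto simp: affine_def P1_rep_def)
  have "rat_of_int (snd x * fst y) = rat_of_int (snd y * fst x)"
    using eq pos by (simp add: slope_def field_simps)
  then have cross: "snd x * fst y = snd y * fst x"
    by (simp only: of_int_eq_iff)
  then have "fst x dvd snd x * fst y" "fst y dvd snd y * fst x"
    by (metis dvd_triv_right)+
  then have "fst x dvd fst y" "fst y dvd fst x"
    using cop by (simp_all add: coprime_dvd_mult_right_iff)
  then have "fst x = fst y"
    using pos by (simp add: zdvd_antisym_nonneg)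
  with cross pos show "x = y"
    by (simp add: prod_eq_iff)
qed

lemma coeff_rat2: "coeff (coeff (rat2 G) l) j = of_int (coeff (coeff G l) j)"
  by (simp add: coeff_map_poly)

lemma of_int_biev:
  "rat_of_int (biev e1 e2 G x1 x2 y1 y2)
    = biev e1 e2 (rat2 G) (of_int x1) (of_int x2) (of_int y1) (of_int y2)"
  by (simp add: biev_def coeff_rat2)

lemma bideg_le_rat2: "bideg_le e1 e2 G \<Longrightarrow> bideg_le e1 e2 (rat2 G)"
  by (simp add: bideg_le_map_poly)

text \<open>Links the integer values of a form, on which congruences act, with zeros over the
  rationals, to which the resultant applies.\<close>

lemma bev_eq_0_iff:
  assumes "bideg_le e1 e2 G" "affine (fst P)" "affine (snd P)"
  shows "bev e1 e2 G P = 0 \<longleftrightarrow> ev2 (rat2 G) (slope (fst P)) (slope (snd P)) = 0"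
proof -
  obtain x1 x2 y1 y2 where P: "P = ((x1, x2), (y1, y2))"
    by (metis prod.collapse)
  have pos: "x1 > 0" "y1 > 0"
    using assms by (simp_all add: affine_def P)
  have "rat_of_int (bev e1 e2 G P)
      = biev e1 e2 (rat2 G) (of_int x1) (slope (x1, x2) * of_int x1) (of_int y1) (slope (y1, y2) * of_int y1)"
    using pos by (simp add: bev_def P of_int_biev slope_def)
  also have "\<dots> = of_int x1 ^ e1 * of_int y1 ^ e2 * ev2 (rat2 G) (slope (x1, x2)) (slope (y1, y2))"
    by (rule biev_scale[OF bideg_le_rat2[OF assms(1)]])
  finally have "bev e1 e2 G P = 0 \<longleftrightarrow> of_int x1 ^ e1 * of_int y1 ^ e2 * ev2 (rat2 G) (slope (x1, x2)) (slope (y1, y2)) = 0"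
    by (metis of_int_eq_0_iff)
  then show ?thesis
    using pos by (simp add: P)
qed

lemma pderiv_rat2: "pderiv (rat2 G) = rat2 (pderiv G)"
  by (intro poly_eqI) (simp add: coeff_pderiv coeff_map_poly of_nat_poly del: of_nat_Suc)

lemma coeff_coeff_pderiv:
  "coeff (coeff (pderiv G) l) j = of_nat (Suc l) * coeff (coeff G (Suc l)) j"
  by (simp add: coeff_pderiv of_nat_poly del: of_nat_Suc)

lemma bideg_le_pderiv:
  fixes G :: "int poly poly"
  assumes "bideg_le e1 e2 G"
  shows "bideg_le e1 (e2 - 1) (pderiv G)"
  unfolding bideg_le_def
proof (intro conjI allI)
  show "degree (pderiv G) \<le> e2 - 1"
    using assms by (simp add: bideg_le_def degree_pderiv diff_le_mono)
  show "degree (coeff (pderiv G) l) \<le> e1" for l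
  proof (intro degree_le allI impI)
    fix i assume "e1 < i"
    then have "coeff (coeff G (Suc l)) i = 0"
      using assms by (intro coeff_eq_0) (auto simp: bideg_le_def intro: le_less_trans)
    then show "coeff (coeff (pderiv G) l) i = 0"
      by (simp add: coeff_coeff_pderiv)
  qed
qed

section \<open>Fibres and intersections of an irreducible affine curve\<close>

context
  fixes F :: "rat poly poly" and d1 d2 :: nat
  assumes irr: "irreducible F" and degF: "degree F = d2" and d: "d1 \<ge> 1" "d2 \<ge> 1"
    and bideg: "bideg_le d1 d2 F" and top: "\<exists>l. coeff (coeff F l) d1 \<noteq> 0"
begin

text \<open>A vertical line inside the curve would make a linear polynomial in \<open>t\<close>
  alone the only factor of \<open>F\<close>, contradicting its positive degree in
  \<open>u\<close>.\<close>

lemma card_fiber_le: "finite {u. ev2 F t u = 0}" "card {u. ev2 F t u = 0} \<le> d2"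
proof -
  have nz: "slice t F \<noteq> 0"
  proof
    assume "slice t F = 0"
    then have "poly (coeff F l) t = 0" for l
      using coeff_slice[of t F l] by simp
    then have "[:[:- t, 1:]:] dvd F"
      by (simp add: const_poly_dvd_iff poly_eq_0_iff_dvd)
    then obtain k where k: "F = [:[:- t, 1:]:] * k" ..
    have "\<not> [:[:- t, 1:]:] dvd 1"
      by (simp add: is_unit_poly_iff)
    then have "k dvd 1"
      using irr k irreducibleD by blast
    then obtain c where "k = [:c:]"
      by (auto simp: is_unit_poly_iff)
    then show False
      using k degF d by simp
  qed
  have eq: "{u. ev2 F t u = 0} = {u. poly (slice t F) u = 0}"
    by (simp add: poly_slice)
  show "finite {u. ev2 F t u = 0}"
    unfolding eq using nz by (rule poly_roots_finite)
  show "card {u. ev2 F t u = 0} \<le> d2"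
    unfolding eq using card_poly_roots_bound[OF nz] degree_slice_le[of t F] degF by simp
qed

text \<open>The fibre is the intersection with a line of bidegree \<open>(0, 1)\<close>. If
  \<open>F\<close> divided the equation of the line, the cofactor would be constant in
  \<open>u\<close>, and \<open>top\<close> would force a positive degree in \<open>t\<close> on an
  equation free of \<open>t\<close>.\<close>

lemma card_horizontal_fiber_le: "finite {t. ev2 F t u = 0}" "card {t. ev2 F t u = 0} \<le> d1"
proof -
  define G where "G = [:- [:u:], 1:]"
  have zero: "ev2 G t u = 0" for t
    by (simp add: G_def ev2_def)
  have "bideg_le 0 1 G"
    by (auto simp: bideg_le_def G_def coeff_pCons split: nat.split)
  moreover have "\<not> F dvd G"
  proof
    assume "F dvd G"
    then obtain k where k: "G = F * k" ..
    have "G \<noteq> 0"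
      by (simp add: G_def)
    then have "degree G = degree F + degree k"
      using k degree_mult_eq[of F k] by auto
    then have "degree k = 0"
      using degF d by (simp add: G_def)
    then obtain c where c: "k = [:c:]"
      by (auto elim: degree_eq_zeroE)
    obtain l where l: "coeff (coeff F l) d1 \<noteq> 0"
      using top ..
    have "coeff G l = coeff F l * c"
      by (simp add: k c mult.commute)
    moreover have "c \<noteq> 0"
      using \<open>G \<noteq> 0\<close> k c by auto
    moreover have "coeff F l \<noteq> 0"
      using l by auto
    ultimately have "degree (coeff G l) = degree (coeff F l) + degree c"
      by (simp add: degree_mult_eq)
    moreover have "degree (coeff F l) \<ge> d1"
      using l by (rule le_degree)
    moreover have "degree (coeff G l) = 0"
      by (auto simp: G_def coeff_pCons split: nat.split)
    ultimately show False
      using d by simp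
  qed
  ultimately have "finite {t. \<exists>u. ev2 F t u = 0 \<and> ev2 G t u = 0}" "card {t. \<exists>u. ev2 F t u = 0 \<and> ev2 G t u = 0} \<le> d1"
    using card_common_zeros_le[OF irr degF bideg d(2), of 0 1 G] by auto
  moreover have "{t. ev2 F t u = 0} \<subseteq> {t. \<exists>u. ev2 F t u = 0 \<and> ev2 G t u = 0}"
    using zero by auto
  ultimately show "finite {t. ev2 F t u = 0}" "card {t. ev2 F t u = 0} \<le> d1"
    using finite_subset[of "{t. ev2 F t u = 0}" "{t. \<exists>u. ev2 F t u = 0 \<and> ev2 G t u = 0}"]
      card_mono[of "{t. \<exists>u. ev2 F t u = 0 \<and> ev2 G t u = 0}" "{t. ev2 F t u = 0}"] by simp_all
qed

lemma card_points_le: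
  assumes S: "\<And>P. P \<in> S \<Longrightarrow> affine (fst P) \<and> affine (snd P) \<and> ev2 F (slope (fst P)) (slope (snd P)) = 0"
    and T: "finite T" "(\<lambda>P. slope (fst P)) ` S \<subseteq> T"
  shows "card S \<le> d2 * card T"
proof -
  define f where "f P = (slope (fst P), slope (snd P))" for P
  have "inj_on f S"
  proof (rule inj_onI)
    fix P Q assume "P \<in> S" "Q \<in> S" "f P = f Q"
    then show "P = Q"
      using S[of P] S[of Q] slope_inj by (auto simp: f_def prod_eq_iff[of P Q] dest: inj_onD)
  qed
  then have "card S = card (f ` S)"
    by (simp add: card_image)
  also have "\<dots> \<le> card (Sigma T (\<lambda>t. {u. ev2 F t u = 0}))"
    using S T card_fiber_le by (intro card_mono finite_SigmaI) (auto simp: f_def)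
  also have "\<dots> = (\<Sum>t\<in>T. card {u. ev2 F t u = 0})"
    using T card_fiber_le by (intro card_SigmaI) auto
  also have "\<dots> \<le> (\<Sum>t\<in>T. d2)"
    using card_fiber_le by (intro sum_mono)
  finally show ?thesis
    by (simp add: mult.commute)
qed

lemma card_points_le_horizontal:
  assumes S: "\<And>P. P \<in> S \<Longrightarrow> affine (fst P) \<and> affine (snd P) \<and> ev2 F (slope (fst P)) (slope (snd P)) = 0"
    and T: "finite T" "snd ` S \<subseteq> T"
  shows "card S \<le> d1 * card T"
proof -
  define f where "f P = (snd P, slope (fst P))" for P :: "(int \<times> int) \<times> (int \<times> int)"
  have "inj_on f S"
  proof (rule inj_onI)
    fix P Q assume "P \<in> S" "Q \<in> S" "f P = f Q"
    then show "P = Q"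
      using S[of P] S[of Q] slope_inj by (auto simp: f_def prod_eq_iff[of P Q] dest: inj_onD)
  qed
  then have "card S = card (f ` S)"
    by (simp add: card_image)
  also have "\<dots> \<le> card (Sigma T (\<lambda>y. {t. ev2 F t (slope y) = 0}))"
    using S T card_horizontal_fiber_le by (intro card_mono finite_SigmaI) (auto simp: f_def)
  also have "\<dots> = (\<Sum>y\<in>T. card {t. ev2 F t (slope y) = 0})"
    using T card_horizontal_fiber_le by (intro card_SigmaI) auto
  also have "\<dots> \<le> (\<Sum>y\<in>T. d1)"
    using card_horizontal_fiber_le by (intro sum_mono)
  finally show ?thesis
    by (simp add: mult.commute)
qed

lemma card_common_points_le:
  assumes S: "\<And>P. P \<in> S \<Longrightarrow> affine (fst P) \<and> affine (snd P) \<and> ev2 F (slope (fst P)) (slope (snd P)) = 0"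
    and G: "bideg_le e1 e2 G" "\<not> F dvd G" "\<And>P. P \<in> S \<Longrightarrow> ev2 G (slope (fst P)) (slope (snd P)) = 0"
  shows "card S \<le> d2 * (d1 * e2 + d2 * e1)"
proof -
  let ?T = "{t. \<exists>u. ev2 F t u = 0 \<and> ev2 G t u = 0}"
  have "card S \<le> d2 * card ?T"
  proof (rule card_points_le[OF S])
    show "finite ?T"
      by (rule card_common_zeros_le(1)[OF irr degF bideg d(2) G(1,2)])
    show "(\<lambda>P. slope (fst P)) ` S \<subseteq> ?T"
      using S G(3) by blast
  qed
  also have "\<dots> \<le> d2 * (d1 * e2 + d2 * e1)"
    by (intro mult_left_mono card_common_zeros_le(2)[OF irr degF bideg d(2) G(1,2)]) simp
  finally show ?thesis .
qed

text \<open>At good points the curve of \<open>\<Gamma>\<close> is a graph modulo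
  \<open>q ^ s\<close>. There are at most \<open>q * e2\<close> residue classes, and in each of them
  one auxiliary form of degree at most \<open>d2 - 1\<close> in \<open>u\<close> vanishes at all the
  points, so the resultant bounds their number.\<close>

lemma card_good_points_le:
  fixes l k M X1 X2 e1 e2 :: nat and \<Gamma> :: "int poly poly"
  defines "q \<equiv> l ^ k" and "s \<equiv> (M + 1) * d2"
  assumes l: "prime l" and k: "k \<ge> 1"
    and size: "s\<^sup>2 * X1 ^ (2 * M) * X2 ^ (2 * (d2 - 1)) < q ^ (s - 1)"
    and \<Gamma>: "bideg_le e1 e2 \<Gamma>" and e2: "e2 \<ge> 1"
    and S: "finite S" "\<And>P. P \<in> S \<Longrightarrow> affine (fst P) \<and> affine (snd P) \<and> ev2 F (slope (fst P)) (slope (snd P)) = 0"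
    and box: "\<And>P. P \<in> S \<Longrightarrow> height1 (fst P) \<le> int X1 \<and> height1 (snd P) \<le> int X2"
    and zero: "\<And>P. P \<in> S \<Longrightarrow> bev e1 e2 \<Gamma> P = 0"
    and good: "\<And>P. P \<in> S \<Longrightarrow> \<not> int l dvd fst (fst P) * fst (snd P) * bev e1 (e2 - 1) (pderiv \<Gamma>) P"
  shows "card S \<le> q * e2 * (d2 * (d1 * (d2 - 1) + d2 * M))"
proof -
  define K where "K = k * s"
  have s: "s \<ge> 1"
    using d by (simp add: s_def)
  have qs: "int q ^ s = int l ^ K"
    by (simp add: q_def K_def power_mult)
  have K: "K \<ge> 1"
    using k s by (simp add: K_def)
  have prime: "prime (int l)"
    using l by simp
  have l_dvd_q: "int l dvd int q"
    using k by (simp add: q_def dvd_power)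
  have l_dvd_qs: "int l dvd int q ^ s"
    using K by (simp add: qs dvd_power)
  have cop: "coprime a (int l)" if "\<not> int l dvd a" for a
    using prime_imp_coprime[OF prime that] by (simp add: coprime_commute)
  have inv: "\<exists>t. [b = t * a] (mod int q ^ s)" if "\<not> int l dvd a" for a b :: int
  proof -
    have "coprime a (int q ^ s)"
      unfolding qs using cop[OF that] by simp
    then obtain c where "[a * c = 1] (mod int q ^ s)"
      using cong_solve_coprime_int by blast
    then have "[b * (a * c) = b * 1] (mod int q ^ s)"
      by (intro cong_mult cong_refl)
    then show ?thesis
      by (intro exI[of _ "b * c"]) (simp add: cong_sym mult_ac)
  qed
  have unit: "\<not> int l dvd fst (fst P)" "\<not> int l dvd fst (snd P)" "\<not> int l dvd bev e1 (e2 - 1) (pderiv \<Gamma>) P" if "P \<in> S" for P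
    using good[OF that] by auto
  \<comment> \<open>The integers \<open>t P\<close> and \<open>u P\<close> represent the slopes of
    \<open>P\<close> modulo \<open>q ^ s\<close>; they exist because \<open>l\<close> divides
    neither \<open>fst (fst P)\<close> nor \<open>fst (snd P)\<close>.\<close>
  obtain t where t: "\<And>P. P \<in> S \<Longrightarrow> [snd (fst P) = t P * fst (fst P)] (mod int q ^ s)"
    using bchoice[of S "\<lambda>P t. [snd (fst P) = t * fst (fst P)] (mod int q ^ s)"] inv unit by blast
  obtain u where u: "\<And>P. P \<in> S \<Longrightarrow> [snd (snd P) = u P * fst (snd P)] (mod int q ^ s)"
    using bchoice[of S "\<lambda>P u. [snd (snd P) = u * fst (snd P)] (mod int q ^ s)"] inv unit by blast
  have ev: "[bev a1 a2 G P = fst (fst P) ^ a1 * fst (snd P) ^ a2 * ev2 G (t P) (u P)] (mod int q ^ s)"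
    if "P \<in> S" "bideg_le a1 a2 G" for P a1 a2 G
    using biev_cong[OF t[OF that(1)] u[OF that(1)], of a1 a2 G "fst (fst P)" "fst (snd P)"]
    by (simp only: bev_def biev_scale[OF that(2)])
  have \<Gamma>0: "int q ^ s dvd ev2 \<Gamma> (t P) (u P)" if "P \<in> S" for P
  proof -
    have "int q ^ s dvd fst (fst P) ^ e1 * fst (snd P) ^ e2 * ev2 \<Gamma> (t P) (u P)"
      using cong_sym[OF ev[OF that \<Gamma>]] zero[OF that] by (simp add: cong_0_iff)
    moreover have "coprime (int q ^ s) (fst (fst P) ^ e1 * fst (snd P) ^ e2)"
      unfolding qs using cop[OF unit(1)[OF that]] cop[OF unit(2)[OF that]] by (simp add: coprime_commute)
    ultimately show ?thesis
      by (simp add: coprime_dvd_mult_right_iff)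
  qed
  have \<Gamma>1: "\<not> int l dvd ev2 (pderiv \<Gamma>) (t P) (u P)" if "P \<in> S" for P
  proof
    assume "int l dvd ev2 (pderiv \<Gamma>) (t P) (u P)"
    then have "[fst (fst P) ^ e1 * fst (snd P) ^ (e2 - 1) * ev2 (pderiv \<Gamma>) (t P) (u P) = 0] (mod int l)"
      by (simp add: cong_0_iff)
    with cong_dvd_modulus[OF ev[OF that bideg_le_pderiv[OF \<Gamma>]] l_dvd_qs]
    have "[bev e1 (e2 - 1) (pderiv \<Gamma>) P = 0] (mod int l)"
      by (rule cong_trans)
    then show False
      using unit[OF that] by (simp add: cong_0_iff)
  qed
  \<comment> \<open>Classes fix \<open>t\<close> modulo \<open>q\<close> but \<open>u\<close> only
    modulo \<open>l\<close>: given \<open>t0\<close>, the residue of \<open>u\<close> is a simple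
    root of a polynomial of degree at most \<open>e2\<close>, and Hensel lifting determines the
    rest.\<close>
  define C where "C = Sigma {0..<int q} (\<lambda>t0. {u \<in> {0..<int l}. int l dvd poly (slice t0 \<Gamma>) u \<and> \<not> int l dvd poly (pderiv (slice t0 \<Gamma>)) u})"
  have "finite C"
    unfolding C_def by (intro finite_SigmaI finite_Collect_residues) simp
  have card_C: "card C \<le> q * e2"
  proof -
    have "card C = (\<Sum>t0\<in>{0..<int q}. card {u \<in> {0..<int l}. int l dvd poly (slice t0 \<Gamma>) u \<and> \<not> int l dvd poly (pderiv (slice t0 \<Gamma>)) u})"
      unfolding C_def by (intro card_SigmaI ballI finite_Collect_residues) simp
    also have "\<dots> \<le> (\<Sum>t0\<in>{0..<int q}. e2)"
    proof (rule sum_mono)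
      fix t0
      show "card {u \<in> {0..<int l}. int l dvd poly (slice t0 \<Gamma>) u \<and> \<not> int l dvd poly (pderiv (slice t0 \<Gamma>)) u} \<le> e2"
        using card_simple_roots_mod_prime[OF prime, of "slice t0 \<Gamma>"] degree_slice_le[of t0 \<Gamma>] \<Gamma>
        by (simp add: bideg_le_def)
    qed
    finally show ?thesis
      by simp
  qed
  define \<kappa> where "\<kappa> P = (t P mod int q, u P mod int l)" for P
  have q0: "int q > 0" "int l > 0"
    using l by (simp_all add: q_def prime_gt_0_nat)
  have red: "[t P = t P mod int q] (mod int q)" "[t P = t P mod int q] (mod int l)" "[u P = u P mod int l] (mod int l)" for P
    using cong_dvd_modulus[of "t P" "t P mod int q" "int q" "int l"] l_dvd_q by (auto simp: cong_def mod_mod_cancel)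
  have in_C: "\<kappa> P \<in> C" and simple: "\<not> int l dvd ev2 (pderiv \<Gamma>) (fst (\<kappa> P)) (snd (\<kappa> P))" if "P \<in> S" for P
  proof -
    have "int l dvd ev2 \<Gamma> (t P) (u P)"
      using \<Gamma>0[OF that] l_dvd_qs dvd_trans by blast
    then have 0: "int l dvd ev2 \<Gamma> (t P mod int q) (u P mod int l)"
      using cong_dvd_iff[OF ev2_cong[OF red(2,3)]] by blast
    show 1: "\<not> int l dvd ev2 (pderiv \<Gamma>) (fst (\<kappa> P)) (snd (\<kappa> P))"
      using \<Gamma>1[OF that] cong_dvd_iff[OF ev2_cong[OF red(2,3)]] by (simp add: \<kappa>_def)
    show "\<kappa> P \<in> C"
      using 0 1 q0 by (simp add: C_def \<kappa>_def poly_slice pderiv_slice)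
  qed
  have fiber: "card {P \<in> S. \<kappa> P = c} \<le> d2 * (d1 * (d2 - 1) + d2 * M)" for c
  proof (cases "{P \<in> S. \<kappa> P = c} = {}")
    case True
    show ?thesis
      unfolding True by simp
  next
    case False
    then obtain P0 where "P0 \<in> S" "\<kappa> P0 = c"
      by auto
    then have "coprime (ev2 (pderiv \<Gamma>) (fst c) (snd c)) (int l)"
      using simple[of P0] by (intro cop) simp
    \<comment> \<open>The index \<open>K - 1\<close> gives the modulus \<open>l ^ K = q ^ s\<close>.
      Hensel lifting sees the class modulo \<open>l\<close>, whereas the Taylor expansion below uses
      \<open>t\<close> modulo \<open>q\<close>.\<close>
    then obtain h where h: "\<And>t u. [t = fst c] (mod int l) \<Longrightarrow> [u = snd c] (mod int l) \<Longrightarrow>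
        int l ^ Suc (K - 1) dvd ev2 \<Gamma> t u \<Longrightarrow> [u = poly h t] (mod int l ^ Suc (K - 1))"
      using hensel_poly[of \<Gamma> "fst c" "snd c" "int l" "K - 1"] by blast
    have D: "d2 - 1 + 1 = d2" and q1: "q \<ge> 1"
      using q0 d by simp_all
    obtain G :: "int poly poly" where G: "G \<noteq> 0" "bideg_le M (d2 - 1) G"
      "\<And>x1 x2 y1 y2 t u. \<bar>x1\<bar> \<le> int X1 \<Longrightarrow> \<bar>x2\<bar> \<le> int X1 \<Longrightarrow> \<bar>y1\<bar> \<le> int X2 \<Longrightarrow> \<bar>y2\<bar> \<le> int X2 \<Longrightarrow>
       [x2 = t * x1] (mod int q ^ s) \<Longrightarrow> [y2 = u * y1] (mod int q ^ s) \<Longrightarrow>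
       [t = fst c] (mod int q) \<Longrightarrow> [u = poly h t] (mod int q ^ s) \<Longrightarrow> biev M (d2 - 1) G x1 x2 y1 y2 = 0"
      by (rule ex_small_poly_on_residue_class[where q = q and M = M and D = "d2 - 1" and ?X1.0 = X1 and ?X2.0 = X2
            and h = h and ?t0.0 = "fst c", unfolded D, folded s_def, OF q1 size]) (rule that)
    show ?thesis
    proof (rule card_common_points_le[of _ M "d2 - 1" "rat2 G"])
      show "bideg_le M (d2 - 1) (rat2 G)"
        by (rule bideg_le_rat2[OF G(2)])
      have "rat2 G \<noteq> 0"
        using G(1) by (auto simp: poly_eq_iff coeff_rat2)
      \<comment> \<open>This is why the auxiliary form has degree at most \<open>d2 - 1\<close> in
        \<open>u\<close>: no nonzero multiple of \<open>F\<close> is that small.\<close>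
      then show "\<not> F dvd rat2 G"
        using bideg_le_rat2[OF G(2)] dvd_imp_degree_le[of F "rat2 G"] degF d by (auto simp: bideg_le_def)
      fix P assume P: "P \<in> {P \<in> S. \<kappa> P = c}"
      then have PS: "P \<in> S" and c: "c = \<kappa> P"
        by auto
      show "affine (fst P) \<and> affine (snd P) \<and> ev2 F (slope (fst P)) (slope (snd P)) = 0"
        using S PS by blast
      have "[u P = poly h (t P)] (mod int q ^ s)"
        using h[of "t P" "u P"] red[of P] \<Gamma>0[OF PS] K by (simp add: c \<kappa>_def qs)
      then have "bev M (d2 - 1) G P = 0"
        unfolding bev_def using box[OF PS] t[OF PS] u[OF PS] red(1)[of P]
        by (intro G(3)[of _ _ _ _ "t P" "u P"]) (auto simp: height1_def c \<kappa>_def)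
      then show "ev2 (rat2 G) (slope (fst P)) (slope (snd P)) = 0"
        using bev_eq_0_iff[OF G(2)] S PS by blast
    qed
  qed
  have "S = (\<Union>c\<in>C. {P \<in> S. \<kappa> P = c})"
    using in_C by auto
  then have "card S \<le> (\<Sum>c\<in>C. card {P \<in> S. \<kappa> P = c})"
    using card_UN_le[OF \<open>finite C\<close>, of "\<lambda>c. {P \<in> S. \<kappa> P = c}"] by simp
  also have "\<dots> \<le> (\<Sum>c\<in>C. d2 * (d1 * (d2 - 1) + d2 * M))"
    by (intro sum_mono fiber)
  also have "\<dots> = card C * (d2 * (d1 * (d2 - 1) + d2 * M))"
    by simp
  also have "\<dots> \<le> q * e2 * (d2 * (d1 * (d2 - 1) + d2 * M))"
    using card_C by (rule mult_right_mono) simp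
  finally show ?thesis .
qed

end

section \<open>Counting affine points\<close>

text \<open>The constant is \<open>144 = 16 * 9\<close>. The powers of 16 absorb the square of
  \<open>(M + 1) * d\<close>, those of 9 absorb \<open>X2 <= exp M <= 3 ^ M\<close>, and
  \<open>R ^ d = X1 ^ 2\<close> turns \<open>X1 ^ (2 * M)\<close> into
  \<open>R ^ (M * d)\<close>.\<close>

lemma size_condition:
  fixes M d X1 X2 q :: nat
  assumes M: "M \<ge> 1" "ln (real X2) \<le> real M" and d: "d \<ge> 1" and X: "X1 \<ge> 1" "X2 \<ge> 1"
    and q: "144 * real X1 powr (2 / real d) \<le> real q"
  shows "((M + 1) * d)\<^sup>2 * X1 ^ (2 * M) * X2 ^ (2 * (d - 1)) < q ^ ((M + 1) * d - 1)"
proof -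
  define R where "R = real X1 powr (2 / real d)"
  have R: "R \<ge> 1"
    using X d by (simp add: R_def ge_one_powr_ge_zero)
  have Rd: "R ^ d = real X1 ^ 2"
    using X d by (simp add: R_def powr_power flip: powr_numeral)
  have "(M + 1) * d < 4 ^ (M * d)"
  proof -
    have "M + 1 \<le> 2 ^ M"
      by (simp only: Suc_eq_plus1[symmetric] Suc_le_eq less_exp)
    then have "(M + 1) * d < 2 ^ M * 2 ^ d"
      using d by (intro mult_le_less_imp_less less_exp) auto
    also have "\<dots> = 2 ^ (M + d)"
      by (simp add: power_add)
    also have "\<dots> \<le> 2 ^ (2 * (M * d))"
    proof (rule power_increasing)
      have "M * 1 \<le> M * d" "1 * d \<le> M * d"
        by (rule mult_le_mono2[OF d], rule mult_le_mono1[OF M(1)])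
      then show "M + d \<le> 2 * (M * d)"
        by linarith
    qed simp
    also have "\<dots> = 4 ^ (M * d)"
      by (simp add: power_mult)
    finally show ?thesis .
  qed
  then have "((M + 1) * d)\<^sup>2 < (4 ^ (M * d))\<^sup>2"
    by (intro power_strict_mono) auto
  also have "\<dots> = 16 ^ (M * d)"
    by (simp add: power2_eq_square flip: power_mult_distrib)
  finally have "real (((M + 1) * d)\<^sup>2) < real (16 ^ (M * d))"
    by (simp only: of_nat_less_iff)
  then have 1: "real (((M + 1) * d)\<^sup>2) < 16 ^ (M * d)"
    by simp
  have 2: "real X2 ^ (2 * (d - 1)) \<le> 9 ^ (M * d)"
  proof -
    have "real X2 = exp (ln (real X2))"
      using X by simp
    also have "\<dots> \<le> exp (real M)"
      using M by simp
    also have "\<dots> = exp 1 ^ M"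
      by (simp flip: exp_of_nat_mult)
    also have "\<dots> \<le> 3 ^ M"
      by (intro power_mono exp_le) simp
    finally have "real X2 ^ (2 * (d - 1)) \<le> (3 ^ M) ^ (2 * (d - 1))"
      by (intro power_mono) auto
    also have "\<dots> \<le> (3 ^ M) ^ (2 * d)"
      by (intro power_increasing) auto
    also have "\<dots> = (3 ^ 2) ^ (M * d)"
      by (simp only: power_mult[symmetric] mult_ac)
    also have "\<dots> = (9 :: real) ^ (M * d)"
      by simp
    finally show ?thesis .
  qed
  have "real (((M + 1) * d)\<^sup>2 * X1 ^ (2 * M) * X2 ^ (2 * (d - 1)))
      = real (((M + 1) * d)\<^sup>2) * real X2 ^ (2 * (d - 1)) * real X1 ^ (2 * M)"
    by (simp add: mult_ac)
  also have "\<dots> < 16 ^ (M * d) * 9 ^ (M * d) * real X1 ^ (2 * M)"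
    using 1 2 X by (intro mult_strict_right_mono mult_less_le_imp_less) auto
  also have "\<dots> = 144 ^ (M * d) * (R ^ d) ^ M"
    by (simp add: Rd power_mult flip: power_mult_distrib)
  also have "\<dots> = (144 * R) ^ (M * d)"
    by (simp add: power_mult_distrib mult.commute flip: power_mult)
  also have "\<dots> \<le> (144 * R) ^ ((M + 1) * d - 1)"
    using R d by (intro power_increasing) auto
  also have "\<dots> \<le> real q ^ ((M + 1) * d - 1)"
    using q R by (intro power_mono) (auto simp: R_def)
  finally show ?thesis
    by (simp only: of_nat_power[symmetric] of_nat_less_iff)
qed

text \<open>The coefficients of \<open>\<Gamma>\<close> cost \<open>W ^ 6\<close>. One more
  \<open>W\<close> pays for \<open>X1\<close> and the factor \<open>e2\<close> from differentiation,
  another for the number and the size of the monomials.\<close>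

lemma good_value_bound:
  fixes \<Gamma> :: "int poly poly" and e1 e2 X1 X2 :: nat
  defines "W \<equiv> 2 * ((e1 + 1) * (e2 + 1)) * (X1 ^ e1 * X2 ^ e2)"
  assumes \<Gamma>: "bideg_le e1 e2 \<Gamma>" "\<And>l j. \<bar>coeff (coeff \<Gamma> l) j\<bar> \<le> int (W ^ 6)" and e: "e1 \<ge> 1" "e2 \<ge> 1"
    and X: "X1 \<ge> 1" "X2 \<ge> 1"
    and P: "height1 (fst P) \<le> int X1" "height1 (snd P) \<le> int X2"
  shows "\<bar>fst (fst P) * fst (snd P) * bev e1 (e2 - 1) (pderiv \<Gamma>) P\<bar> \<le> int (W ^ 8)"
proof -
  let ?H = "X1 ^ e1 * X2 ^ e2"
  have "\<bar>coeff (coeff (pderiv \<Gamma>) l) j\<bar> \<le> int e2 * int (W ^ 6)" for l j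
  proof (cases "Suc l \<le> e2")
    case True
    have "\<bar>coeff (coeff (pderiv \<Gamma>) l) j\<bar> = int (Suc l) * \<bar>coeff (coeff \<Gamma> (Suc l)) j\<bar>"
      by (simp only: coeff_coeff_pderiv abs_mult abs_of_nat)
    also have "\<dots> \<le> int e2 * int (W ^ 6)"
      using True \<Gamma>(2) by (intro mult_mono) auto
    finally show ?thesis .
  next
    case False
    then have "coeff \<Gamma> (Suc l) = 0"
      using \<Gamma>(1) by (intro coeff_eq_0) (auto simp: bideg_le_def)
    then show ?thesis
      by (simp add: coeff_coeff_pderiv)
  qed
  then have "\<bar>bev e1 (e2 - 1) (pderiv \<Gamma>) P\<bar>
      \<le> int ((e1 + 1) * (e2 - 1 + 1)) * ((int e2 * int (W ^ 6)) * (int X1 ^ e1 * int X2 ^ (e2 - 1)))"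
    unfolding bev_def using P by (intro abs_biev_le) (auto simp: height1_def)
  moreover have "\<bar>fst (fst P)\<bar> \<le> int X1" "\<bar>fst (snd P)\<bar> \<le> int X2"
    using P by (auto simp: height1_def)
  ultimately have "\<bar>fst (fst P) * fst (snd P) * bev e1 (e2 - 1) (pderiv \<Gamma>) P\<bar>
      \<le> int X1 * int X2 * (int ((e1 + 1) * (e2 - 1 + 1)) * ((int e2 * int (W ^ 6)) * (int X1 ^ e1 * int X2 ^ (e2 - 1))))"
    unfolding abs_mult by (intro mult_mono) auto
  also have "\<dots> = int ((X1 * e2) * ((e1 + 1) * e2 * (X1 ^ e1 * X2 ^ e2)) * W ^ 6)"
  proof -
    \<comment> \<open>The factor \<open>X2\<close> bounding \<open>fst (snd P)\<close> restores the
      degree lost by differentiation.\<close>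
    have "int X2 ^ e2 = int X2 * int X2 ^ (e2 - 1)"
      using e by (simp flip: power_Suc)
    then show ?thesis
      using e by simp
  qed
  also have "\<dots> \<le> int (W * W * W ^ 6)"
  proof (intro of_nat_mono mult_le_mono order.refl)
    have "X1 \<le> X1 ^ e1"
      using X e by (simp add: self_le_power)
    also have "\<dots> \<le> ?H"
      using X by simp
    finally have "X1 * e2 \<le> ?H * (2 * ((e1 + 1) * (e2 + 1)))"
      by (rule mult_le_mono) simp
    then show "X1 * e2 \<le> W"
      by (simp only: W_def mult.commute)
    have "(e1 + 1) * e2 \<le> 2 * ((e1 + 1) * (e2 + 1))"
      by simp
    then show "(e1 + 1) * e2 * ?H \<le> W"
      unfolding W_def by (rule mult_le_mono) simp
  qed
  also have "W * W * W ^ 6 = W ^ 8"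
    by (simp add: power_numeral_reduce)
  finally show ?thesis .
qed

lemma ln_ge_half:
  fixes x :: real
  assumes "x \<ge> 2"
  shows "ln x \<ge> 1 / 2"
proof -
  have "exp (1 / 2) ^ 2 = exp (1 :: real)"
    by (simp flip: exp_of_nat_mult)
  also have "\<dots> \<le> 2 ^ 2"
    using exp_le by simp
  finally have "exp (1 / 2) \<le> (2 :: real)"
    by (rule power2_le_imp_le) simp
  with assms show ?thesis
    by (subst ln_ge_iff) auto
qed

text \<open>The argument is \<open>W\<close> of \<open>good_value_bound\<close> at
  \<open>e1 = 3 * d1\<close>, \<open>e2 = 2 * d2 - 1\<close>. Here \<open>37 = 32 + 3 + 2\<close>,
  from the numerical factor, the power of \<open>X1\<close> (via \<open>X1 <= X2 ^ d2\<close>) and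
  the power of \<open>X2\<close>.\<close>

lemma ln_weight_le:
  fixes d1 d2 X1 X2 :: nat
  assumes d: "d1 \<ge> 1" "d2 \<ge> 1" and X: "X1 \<ge> 1" "X2 \<ge> 2" "X1 \<le> X2 ^ d2"
  shows "ln (real (2 * ((3 * d1 + 1) * (2 * d2 - 1 + 1)) * (X1 ^ (3 * d1) * X2 ^ (2 * d2 - 1))))
    \<le> 37 * real d1 * real d2 * ln (real X2)"
proof -
  define n where "n = 2 * ((3 * d1 + 1) * (2 * d2))"
  have lnX2: "ln (real X2) \<ge> 1 / 2"
    using X by (intro ln_ge_half) simp
  have lnX1: "ln (real X1) \<le> real d2 * ln (real X2)" "ln (real X1) \<ge> 0"
  proof -
    have "real X1 \<le> real X2 ^ d2"
      using X(3) by (simp flip: of_nat_power)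
    then have "ln (real X1) \<le> ln (real X2 ^ d2)"
      using X by (subst ln_le_cancel_iff) auto
    then show "ln (real X1) \<le> real d2 * ln (real X2)"
      using X by (simp add: ln_realpow)
  qed (use X in simp)
  have prod: "real d2 \<le> real d1 * real d2"
    using d by simp
  have "n = 12 * (d1 * d2) + 4 * d2"
    by (simp add: n_def algebra_simps)
  then have n16: "real n \<le> 16 * (real d1 * real d2)"
    using prod by simp
  have n1: "n \<ge> 1"
    using d by (simp add: n_def)
  have "2 * ((3 * d1 + 1) * (2 * d2 - 1 + 1)) * (X1 ^ (3 * d1) * X2 ^ (2 * d2 - 1)) = n * (X1 ^ (3 * d1) * X2 ^ (2 * d2 - 1))"
    using d by (simp add: n_def)
  then have "ln (real (2 * ((3 * d1 + 1) * (2 * d2 - 1 + 1)) * (X1 ^ (3 * d1) * X2 ^ (2 * d2 - 1))))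
      = ln (real n) + (real (3 * d1) * ln (real X1) + real (2 * d2 - 1) * ln (real X2))"
    using n1 X by (simp only: of_nat_mult of_nat_power) (simp add: ln_mult ln_realpow)
  also have "ln (real n) \<le> 32 * (real d1 * real d2 * ln (real X2))"
  proof -
    have "ln (real n) \<le> real n"
      using n1 ln_le_minus_one[of "real n"] by simp
    also have "\<dots> \<le> 16 * (real d1 * real d2 * (2 * ln (real X2)))"
      using n16 lnX2 mult_left_mono[of 1 "2 * ln (real X2)" "real d1 * real d2"] by simp
    finally show ?thesis
      by simp
  qed
  also have "real (3 * d1) * ln (real X1) \<le> real (3 * d1) * (real d2 * ln (real X2))"
    using lnX1 by (intro mult_left_mono) auto
  also have "real (2 * d2 - 1) * ln (real X2) \<le> 2 * (real d1 * real d2) * ln (real X2)"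
  proof (rule mult_right_mono)
    have "real (2 * d2 - 1) \<le> 2 * real d2"
      by linarith
    then show "real (2 * d2 - 1) \<le> 2 * (real d1 * real d2)"
      using prod by linarith
  qed (use lnX2 in linarith)
  finally show ?thesis
    by (simp add: algebra_simps)
qed

section \<open>Points of the curve in an affine box\<close>

context
  fixes F :: "int poly poly" and d1 d2 X1 X2 :: nat and S :: "((int \<times> int) \<times> (int \<times> int)) set"
  assumes irr: "irreducible (rat2 F)" and degF: "degree (rat2 F) = d2" and d: "d1 \<ge> 1" "d2 \<ge> 1"
    and bideg: "bideg_le d1 d2 F" and top: "\<exists>l. coeff (coeff (rat2 F) l) d1 \<noteq> 0"
    and X: "X1 \<ge> 1" "X2 \<ge> 2"
  defines "S \<equiv> {P. affine (fst P) \<and> affine (snd P) \<and> ev2 (rat2 F) (slope (fst P)) (slope (snd P)) = 0 \<and>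
    height1 (fst P) \<le> int X1 \<and> height1 (snd P) \<le> int X2}"
begin

lemma finite_affine_box: "finite {x. affine x \<and> height1 x \<le> int X}"
  by (rule finite_subset[of _ "{1..int X} \<times> {- int X..int X}"]) (auto simp: affine_def height1_def)

lemma card_affine_box_le: "card {x. affine x \<and> height1 x \<le> int X} \<le> X * (2 * X + 1)"
proof -
  have "card {x. affine x \<and> height1 x \<le> int X} \<le> card ({1..int X} \<times> {- int X..int X})"
    by (intro card_mono) (auto simp: affine_def height1_def)
  also have "\<dots> = X * (2 * X + 1)"
    by (simp add: card_cartesian_product nat_add_distrib nat_mult_distrib)
  finally show ?thesis .
qed

lemma finite_S: "finite S"
  by (rule finite_subset[OF _ finite_cartesian_product[OF finite_affine_box[of X1] finite_affine_box[of X2]]])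
     (auto simp: S_def)

lemmas bideg_rat = bideg_le_rat2[OF bideg]

lemma S_D: "P \<in> S \<Longrightarrow> affine (fst P) \<and> affine (snd P) \<and> ev2 (rat2 F) (slope (fst P)) (slope (snd P)) = 0"
  by (simp add: S_def)

text \<open>Each \<open>y\<close> in its box carries at most \<open>d1\<close> points. This suffices
  when \<open>X1\<close> exceeds \<open>X2 ^ d2\<close>.\<close>

lemma card_S_le_trivial: "card S \<le> d1 * (3 * X2\<^sup>2)"
proof -
  have "card S \<le> d1 * card {y. affine y \<and> height1 y \<le> int X2}"
    using irr degF d bideg_rat top S_D
    by (rule card_points_le_horizontal) (auto simp: finite_affine_box S_def)
  also have "\<dots> \<le> d1 * (X2 * (2 * X2 + 1))"
    by (intro mult_left_mono card_affine_box_le) simp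
  also have "X2 * (2 * X2 + 1) \<le> X2 * (3 * X2)"
    using X by (intro mult_left_mono) auto
  finally show ?thesis
    by (simp add: power2_eq_square mult_ac)
qed

text \<open>With \<open>e\<^sub>1 = 3d\<^sub>1\<close> and \<open>e\<^sub>2 = 2d\<^sub>2 - 1\<close> there are more coefficients than the Bezout number of a
  bidegree \<open>(e\<^sub>1, e\<^sub>2)\<close> form with \<open>F\<close>, so \<open>\<Gamma>\<close> is forced to be a multiple of \<open>F\<close>, while
  \<open>e\<^sub>2 < 2d\<^sub>2\<close> prevents a double factor. Hence no bound on the coefficients of \<open>F\<close> is needed.\<close>

lemma ex_small_multiple:
  assumes many: "card ((\<lambda>P. slope (fst P)) ` S) > 5 * d1 * d2"
  obtains \<Gamma> :: "int poly poly" where "bideg_le (3 * d1) (2 * d2 - 1) \<Gamma>"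
    "\<And>l j. \<bar>coeff (coeff \<Gamma> l) j\<bar> \<le> int ((2 * ((3 * d1 + 1) * (2 * d2 - 1 + 1)) * (X1 ^ (3 * d1) * X2 ^ (2 * d2 - 1))) ^ 6)"
    "\<And>P. P \<in> S \<Longrightarrow> bev (3 * d1) (2 * d2 - 1) \<Gamma> P = 0"
    "\<not> rat2 F dvd rat2 (pderiv \<Gamma>)"
proof -
  define e1 where "e1 = 3 * d1"
  define e2 where "e2 = 2 * d2 - 1"
  \<comment> \<open>One more than the number of values of \<open>t\<close> that \<open>F\<close> can
    share with a form of bidegree \<open>(e1, e2)\<close> that it does not divide.\<close>
  define m where "m = d1 * e2 + d2 * e1 + 1"
  have e2: "e2 + 1 = 2 * d2"
    using d by (simp add: e2_def)
  have "d1 * e2 + d1 = 2 * (d1 * d2)"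
    using e2 by (metis add_mult_distrib2 mult.left_commute nat_mult_1_right)
  then have m: "m + d1 = 5 * (d1 * d2) + 1"
    by (simp add: m_def e1_def)
  have n: "(e1 + 1) * (e2 + 1) = 6 * (d1 * d2) + 2 * d2"
    unfolding e2 by (simp add: e1_def algebra_simps)
  have "m \<le> card ((\<lambda>P. slope (fst P)) ` S)"
    using many m d by simp
  \<comment> \<open>The resultant counts values of \<open>t\<close>, so \<open>T\<close> takes a
    single point over each of \<open>m\<close> distinct values.\<close>
  then obtain \<Theta> where \<Theta>: "\<Theta> \<subseteq> (\<lambda>P. slope (fst P)) ` S" "card \<Theta> = m"
    by (meson obtain_subset_with_card_n)
  then obtain T where T: "T \<subseteq> S" "inj_on (\<lambda>P. slope (fst P)) T" "(\<lambda>P. slope (fst P)) ` T = \<Theta>"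
    by (auto simp: subset_image_inj)
  have "card T = m" "finite T"
    using T \<Theta>(2) card_image[OF T(2)] finite_subset[OF T(1) finite_S] by simp_all
  have "card T < (e1 + 1) * (e2 + 1)" "card T \<le> 6 * ((e1 + 1) * (e2 + 1) - card T)"
  proof -
    \<comment> \<open>There are \<open>m <= 5 * d1 * d2\<close> equations, and more than
      \<open>d1 * d2\<close> unknowns stay free, so the ratio is below 6.\<close>
    have "m + d1 * d2 + 1 \<le> (e1 + 1) * (e2 + 1)"
      unfolding n using m d by simp
    then show "card T < (e1 + 1) * (e2 + 1)" "card T \<le> 6 * ((e1 + 1) * (e2 + 1) - card T)"
      unfolding \<open>card T = m\<close> using m d by linarith+
  qed
  moreover have "X2 \<ge> 1"
    using X by simp
  moreover have "\<bar>x1\<bar> \<le> int X1 \<and> \<bar>x2\<bar> \<le> int X1 \<and> \<bar>y1\<bar> \<le> int X2 \<and> \<bar>y2\<bar> \<le> int X2"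
    if "((x1, x2), (y1, y2)) \<in> T" for x1 x2 y1 y2
    using that T(1) by (auto simp: S_def height1_def)
  ultimately obtain \<Gamma> :: "int poly poly" where \<Gamma>: "\<Gamma> \<noteq> 0" "bideg_le e1 e2 \<Gamma>"
    "\<And>l j. \<bar>coeff (coeff \<Gamma> l) j\<bar> \<le> int ((2 * ((e1 + 1) * (e2 + 1)) * (X1 ^ e1 * X2 ^ e2)) ^ 6)"
    "\<And>x1 x2 y1 y2. ((x1, x2), (y1, y2)) \<in> T \<Longrightarrow> biev e1 e2 \<Gamma> x1 x2 y1 y2 = 0"
    using ex_small_poly_through_points[OF \<open>finite T\<close>, of e1 e2 X1 X2] X(1) by metis
  have "rat2 \<Gamma> \<noteq> 0"
    using \<Gamma>(1) by (auto simp: poly_eq_iff coeff_rat2)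
  have "rat2 F dvd rat2 \<Gamma>"
  proof (rule ccontr)
    let ?Z = "{t. \<exists>u. ev2 (rat2 F) t u = 0 \<and> ev2 (rat2 \<Gamma>) t u = 0}"
    assume "\<not> rat2 F dvd rat2 \<Gamma>"
    then have Z: "finite ?Z" "card ?Z \<le> d1 * e2 + d2 * e1"
      using card_common_zeros_le[OF irr degF bideg_rat d(2) bideg_le_rat2[OF \<Gamma>(2)]] by auto
    have "\<Theta> \<subseteq> ?Z"
    proof -
      have "slope (fst P) \<in> ?Z" if "P \<in> T" for P
      proof -
        have "P \<in> S"
          using T(1) that by blast
        moreover have "bev e1 e2 \<Gamma> P = 0"
          using \<Gamma>(4)[of "fst (fst P)" "snd (fst P)" "fst (snd P)" "snd (snd P)"] that by (simp add: bev_def)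
        ultimately show ?thesis
          using bev_eq_0_iff[OF \<Gamma>(2), of P] S_D[of P] by blast
      qed
      then show ?thesis
        using T(3) by blast
    qed
    then have "m \<le> card ?Z"
      using card_mono[OF Z(1)] \<Theta>(2) by blast
    then show False
      using Z(2) by (simp add: m_def)
  qed
  then obtain w where w: "rat2 \<Gamma> = rat2 F * w" ..
  have "rat2 F \<noteq> 0" "w \<noteq> 0"
    using w \<open>rat2 \<Gamma> \<noteq> 0\<close> by auto
  then have "degree (rat2 \<Gamma>) = d2 + degree w"
    by (simp add: w degree_mult_eq degF)
  moreover have "degree (rat2 \<Gamma>) \<le> e2"
    using bideg_le_rat2[OF \<Gamma>(2)] by (simp add: bideg_le_def)
  ultimately have deg_w: "degree w < d2"
    using e2 by linarith
  show ?thesis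
  proof (rule that[of \<Gamma>])
    show "bideg_le (3 * d1) (2 * d2 - 1) \<Gamma>"
      using \<Gamma>(2) by (simp add: e1_def e2_def)
    show "\<bar>coeff (coeff \<Gamma> l) j\<bar> \<le> int ((2 * ((3 * d1 + 1) * (2 * d2 - 1 + 1)) * (X1 ^ (3 * d1) * X2 ^ (2 * d2 - 1))) ^ 6)" for l j
      using \<Gamma>(3)[of l j] by (simp only: e1_def e2_def)
    show "bev (3 * d1) (2 * d2 - 1) \<Gamma> P = 0" if "P \<in> S" for P
    proof -
      have "ev2 (rat2 \<Gamma>) (slope (fst P)) (slope (snd P)) = 0"
        using S_D[OF that] by (simp add: w ev2_mult)
      then show ?thesis
        using bev_eq_0_iff[OF \<Gamma>(2), of P] S_D[OF that] by (simp add: e1_def e2_def)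
    qed
    \<comment> \<open>With \<open>\<Gamma> = F * w\<close>, the prime \<open>F\<close> would divide
      \<open>w\<close> or its own derivative in \<open>u\<close>; both are nonzero and of degree
      below \<open>d2\<close>.\<close>
    show "\<not> rat2 F dvd rat2 (pderiv \<Gamma>)"
    proof
      assume "rat2 F dvd rat2 (pderiv \<Gamma>)"
      also have "rat2 (pderiv \<Gamma>) = rat2 F * pderiv w + w * pderiv (rat2 F)"
        by (simp only: pderiv_rat2[symmetric] w pderiv_mult)
      finally have "rat2 F dvd w * pderiv (rat2 F)"
        by (simp add: dvd_add_right_iff)
      then have "rat2 F dvd w \<or> rat2 F dvd pderiv (rat2 F)"
        using irr by (simp add: prime_elem_iff_irreducible[symmetric] prime_elem_dvd_mult_iff)
      moreover have "pderiv (rat2 F) \<noteq> 0" "degree (pderiv (rat2 F)) < d2"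
        using degF d by (auto simp: pderiv_eq_0_iff degree_pderiv)
      ultimately show False
        using dvd_imp_degree_le[of "rat2 F" w] dvd_imp_degree_le[of "rat2 F" "pderiv (rat2 F)"]
          deg_w \<open>w \<noteq> 0\<close> degF by auto
    qed
  qed
qed

text \<open>Points where the derivative of \<open>\<Gamma>\<close> vanishes are counted by the
  resultant. Among the others, \<open>S1\<close>, some prime \<open>l <= n\<close> is good for at
  least half, and the residue class count applies to that half.\<close>

lemma card_S_le_of_prime:
  assumes many: "card ((\<lambda>P. slope (fst P)) ` S) > 5 * d1 * d2" and small: "X1 \<le> X2 ^ d2"
    and ps: "2 * (300 * real d1 * real d2 * ln (real X2)) \<le> (\<Sum>p | prime p \<and> p \<le> n. ln (real p))"
  shows "real (card S) \<le> 5 * real d1 * real d2 ^ 2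
    + 5800 * real n * (real d1 * real d2 ^ 3 * real X1 powr (2 / real d2) * ln (real X2))"
proof -
  define e1 where "e1 = 3 * d1"
  define e2 where "e2 = 2 * d2 - 1"
  define W where "W = 2 * ((e1 + 1) * (e2 + 1)) * (X1 ^ e1 * X2 ^ e2)"
  have e: "e1 \<ge> 1" "e2 \<ge> 1"
    using d by (simp_all add: e1_def e2_def)
  have lnX2: "ln (real X2) \<ge> 1 / 2"
    using X by (intro ln_ge_half) simp
  obtain \<Gamma> :: "int poly poly" where \<Gamma>: "bideg_le e1 e2 \<Gamma>" "\<And>l j. \<bar>coeff (coeff \<Gamma> l) j\<bar> \<le> int (W ^ 6)"
    "\<And>P. P \<in> S \<Longrightarrow> bev e1 e2 \<Gamma> P = 0" "\<not> rat2 F dvd rat2 (pderiv \<Gamma>)"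
    by (rule ex_small_multiple[OF many, folded e1_def e2_def, folded W_def]) (rule that)
  define D where "D P = bev e1 (e2 - 1) (pderiv \<Gamma>) P" for P
  define S0 where "S0 = {P \<in> S. D P = 0}"
  define S1 where "S1 = {P \<in> S. D P \<noteq> 0}"
  have "card S = card S0 + card S1"
    using finite_S by (subst card_Un_disjoint[symmetric]) (auto simp: S0_def S1_def intro!: arg_cong[of _ _ card])
  have "card S0 \<le> d2 * (d1 * (e2 - 1) + d2 * e1)"
  proof (rule card_common_points_le[OF irr degF d bideg_rat top, of S0 e1 "e2 - 1" "rat2 (pderiv \<Gamma>)"])
    show "bideg_le e1 (e2 - 1) (rat2 (pderiv \<Gamma>))"
      by (intro bideg_le_rat2 bideg_le_pderiv \<Gamma>)
    show "\<not> rat2 F dvd rat2 (pderiv \<Gamma>)"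
      by fact
    fix P assume "P \<in> S0"
    then have P: "P \<in> S" "D P = 0"
      by (simp_all add: S0_def)
    show "affine (fst P) \<and> affine (snd P) \<and> ev2 (rat2 F) (slope (fst P)) (slope (snd P)) = 0"
      by (rule S_D[OF P(1)])
    show "ev2 (rat2 (pderiv \<Gamma>)) (slope (fst P)) (slope (snd P)) = 0"
      using bev_eq_0_iff[OF bideg_le_pderiv[OF \<Gamma>(1)], of P] S_D[OF P(1)] P(2) by (simp add: D_def)
  qed
  also have "\<dots> \<le> d2 * (5 * (d1 * d2))"
  proof (rule mult_left_mono)
    have "d1 * (e2 - 1) \<le> d1 * (2 * d2)"
      by (intro mult_left_mono) (auto simp: e2_def)
    then show "d1 * (e2 - 1) + d2 * e1 \<le> 5 * (d1 * d2)"
      by (simp add: e1_def)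
  qed simp
  finally have "real (card S0) \<le> real (d2 * (5 * (d1 * d2)))"
    by (simp only: of_nat_le_iff)
  then have S0: "real (card S0) \<le> 5 * real d1 * real d2 ^ 2"
    by (simp add: power2_eq_square mult_ac)
  define N where "N P = fst (fst P) * fst (snd P) * D P" for P
  have "\<exists>l\<in>{p. prime p \<and> p \<le> n}. card S1 \<le> 2 * card {P \<in> S1. \<not> int l dvd N P}"
  proof (rule ex_prime_good_for_half)
    show "finite S1"
      using finite_S by (simp add: S1_def)
    \<comment> \<open>The values are at most \<open>W ^ 8\<close>, and \<open>8 * 37 = 296\<close>
      is rounded up to 300.\<close>
    show "N P \<noteq> 0 \<and> ln \<bar>real_of_int (N P)\<bar> \<le> 300 * real d1 * real d2 * ln (real X2)" if "P \<in> S1" for P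
    proof
      have P: "P \<in> S" "D P \<noteq> 0"
        using that by (simp_all add: S1_def)
      then show nz: "N P \<noteq> 0"
        using S_D[OF P(1)] by (simp add: N_def affine_def)
      have "\<bar>N P\<bar> \<le> int (W ^ 8)"
        unfolding N_def D_def W_def
        by (rule good_value_bound) (use \<Gamma> e X P(1) in \<open>auto simp: W_def S_def\<close>)
      then have "real_of_int \<bar>N P\<bar> \<le> real_of_int (int (W ^ 8))"
        by (simp only: of_int_le_iff)
      then have "\<bar>real_of_int (N P)\<bar> \<le> real W ^ 8"
        by simp
      then have "ln \<bar>real_of_int (N P)\<bar> \<le> ln (real W ^ 8)"
        using nz X by (subst ln_le_cancel_iff) (auto simp: W_def)
      also have "\<dots> = 8 * ln (real W)"
        using X by (subst ln_realpow) (auto simp: W_def)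
      also have "\<dots> \<le> 8 * (37 * real d1 * real d2 * ln (real X2))"
        unfolding W_def e1_def e2_def using ln_weight_le[OF d X small] by (intro mult_left_mono) auto
      also have "\<dots> \<le> 300 * real d1 * real d2 * ln (real X2)"
        using lnX2 d by simp
      finally show "ln \<bar>real_of_int (N P)\<bar> \<le> 300 * real d1 * real d2 * ln (real X2)" .
    qed
    show "300 * real d1 * real d2 * ln (real X2) > 0"
      using lnX2 d by simp
  qed (use ps in auto)
  then obtain l where l: "prime l" "l \<le> n" and S1: "card S1 \<le> 2 * card {P \<in> S1. \<not> int l dvd N P}"
    by blast
  define R where "R = real X1 powr (2 / real d2)"
  have R: "R \<ge> 1"
    using X d by (simp add: R_def ge_one_powr_ge_zero)
  define Q where "Q = nat \<lceil>144 * R\<rceil>"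
  have Q: "144 * R \<le> real Q" "real Q \<le> 145 * R" "Q \<ge> 1"
    using R unfolding Q_def by linarith+
  \<comment> \<open>The modulus is \<open>q = l ^ (k + 1)\<close>, the first power of
    \<open>l\<close> beyond \<open>Q\<close>; it is at most \<open>l * Q\<close>, hence at most
    \<open>n * Q\<close>.\<close>
  obtain k where k: "l ^ k \<le> Q" "Q < l ^ (k + 1)"
    using ex_power_ivl1[OF prime_ge_2_nat[OF l(1)] Q(3)] by blast
  \<comment> \<open>The least integer allowed by \<open>size_condition\<close>, which keeps the
    degree of the auxiliary form in \<open>t\<close> of order \<open>ln X2\<close>.\<close>
  define M where "M = nat \<lceil>ln (real X2)\<rceil>"
  have M: "M \<ge> 1" "ln (real X2) \<le> real M" "real M \<le> ln (real X2) + 1"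
    using lnX2 unfolding M_def by linarith+
  have "card {P \<in> S1. \<not> int l dvd N P} \<le> l ^ (k + 1) * e2 * (d2 * (d1 * (d2 - 1) + d2 * M))"
  proof (rule card_good_points_le[OF irr degF d bideg_rat top l(1) _ _ \<Gamma>(1) e(2)])
    show "((M + 1) * d2)\<^sup>2 * X1 ^ (2 * M) * X2 ^ (2 * (d2 - 1)) < (l ^ (k + 1)) ^ ((M + 1) * d2 - 1)"
    proof (intro size_condition M d X)
      have "real Q \<le> real (l ^ (k + 1))"
        using k(2) by (simp only: of_nat_le_iff less_imp_le)
      then show "144 * real X1 powr (2 / real d2) \<le> real (l ^ (k + 1))"
        using Q(1) unfolding R_def by linarith
    qed (use X in simp)
    show "finite {P \<in> S1. \<not> int l dvd N P}"
      using finite_S by (simp add: S1_def)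
    fix P assume "P \<in> {P \<in> S1. \<not> int l dvd N P}"
    then have P: "P \<in> S" "\<not> int l dvd N P"
      by (simp_all add: S1_def)
    show "affine (fst P) \<and> affine (snd P) \<and> ev2 (rat2 F) (slope (fst P)) (slope (snd P)) = 0"
      by (rule S_D[OF P(1)])
    show "height1 (fst P) \<le> int X1 \<and> height1 (snd P) \<le> int X2"
      using P(1) by (simp add: S_def)
    show "bev e1 e2 \<Gamma> P = 0"
      by (rule \<Gamma>(3)[OF P(1)])
    show "\<not> int l dvd fst (fst P) * fst (snd P) * bev e1 (e2 - 1) (pderiv \<Gamma>) P"
      using P(2) by (simp add: N_def D_def)
  qed simp
  also have "\<dots> \<le> (n * Q) * (2 * d2) * (d2 * (d1 * d2 + d2 * M))"
  proof (intro mult_le_mono add_le_mono)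
    show "l ^ (k + 1) \<le> n * Q"
      using mult_le_mono[OF l(2) k(1)] by simp
  qed (auto simp: e2_def)
  finally have "real (card {P \<in> S1. \<not> int l dvd N P}) \<le> real ((n * Q) * (2 * d2) * (d2 * (d1 * d2 + d2 * M)))"
    by (simp only: of_nat_le_iff)
  also have "\<dots> = real n * real Q * (2 * real d2 ^ 2) * (real d2 * (real d1 + real M))"
    by (simp add: power2_eq_square algebra_simps)
  also have "\<dots> \<le> real n * (145 * R) * (2 * real d2 ^ 2) * (real d2 * (10 * (real d1 * ln (real X2))))"
  proof (intro mult_mono mult_nonneg_nonneg)
    have "real d1 \<le> real d1 * (2 * ln (real X2))"
      using lnX2 by (simp add: mult_le_cancel_left1)
    moreover have "real M \<le> 3 * ln (real X2)"
      using M lnX2 by linarith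
    moreover have "ln (real X2) \<le> real d1 * ln (real X2)"
      using lnX2 d by (simp add: mult_le_cancel_right1)
    ultimately show "real d1 + real M \<le> 10 * (real d1 * ln (real X2))"
      using lnX2 by linarith
  qed (use Q R lnX2 in auto)
  also have "\<dots> = 2900 * real n * (real d1 * real d2 ^ 3 * R * ln (real X2))"
    by (simp add: power2_eq_square power3_eq_cube algebra_simps)
  finally have "real (card S1) \<le> 5800 * real n * (real d1 * real d2 ^ 3 * R * ln (real X2))"
    using S1 by linarith
  then show ?thesis
    using \<open>card S = card S0 + card S1\<close> S0 by (simp add: R_def)
qed

text \<open>For \<open>X1\<close> above \<open>X2 ^ d2\<close> the trivial bound is enough, and for
  few values of \<open>t\<close> the fibre bound. Otherwise a prime up to
  \<open>n <= c * 300 * d1 * d2 * ln X2\<close> is used; this \<open>n\<close> brings the second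
  logarithm, and \<open>1740000 = 5800 * 300\<close>.\<close>

lemma card_S_le:
  assumes c: "c > 0" "\<And>L. L \<ge> 1 \<Longrightarrow> \<exists>n::nat. real n \<le> c * L \<and> 2 * L \<le> (\<Sum>p | prime p \<and> p \<le> n. ln (real p))"
  shows "real (card S) \<le> (20 + 1740000 * c) * (real d1 ^ 2 * real d2 ^ 4 * real X1 powr (2 / real d2) * ln (real X2) ^ 2)"
proof -
  define R where "R = real X1 powr (2 / real d2)"
  have R: "R \<ge> 1"
    using X d by (simp add: R_def ge_one_powr_ge_zero)
  have lnX2: "ln (real X2) \<ge> 1 / 2"
    using X by (intro ln_ge_half) simp
  \<comment> \<open>Terms without a logarithm are absorbed into \<open>E\<close> at the cost of a
    factor 4, which turns 5 into 20.\<close>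
  have sq: "1 \<le> 4 * ln (real X2) ^ 2"
    using power_mono[OF lnX2, of 2] by (simp add: power_divide)
  have d': "real d1 \<ge> 1" "real d2 \<ge> 1"
    using d by auto
  define E where "E = real d1 ^ 2 * real d2 ^ 4 * R * ln (real X2) ^ 2"
  have E: "E \<ge> 0"
    using R by (simp add: E_def)
  have base: "a * b * r \<le> 4 * E" if "0 \<le> a" "a \<le> real d1 ^ 2" "0 \<le> b" "b \<le> real d2 ^ 4" "0 \<le> r" "r \<le> R" for a b r
  proof -
    have "a * b * r \<le> real d1 ^ 2 * real d2 ^ 4 * R"
      using that by (intro mult_mono) auto
    also have "\<dots> \<le> real d1 ^ 2 * real d2 ^ 4 * R * (4 * ln (real X2) ^ 2)"
      using mult_left_mono[OF sq, of "real d1 ^ 2 * real d2 ^ 4 * R"] R by simp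
    finally show ?thesis
      by (simp add: E_def mult_ac)
  qed
  have pow: "real d1 \<le> real d1 ^ 2" "real d2 ^ 2 \<le> real d2 ^ 4" "1 \<le> real d2 ^ 4"
    using d' by (auto intro: self_le_power power_increasing one_le_power)
  have small: "5 * real d1 * real d2 ^ 2 \<le> 20 * E"
    using base[of "real d1" "real d2 ^ 2" 1] pow R by simp
  have "real (card S) \<le> 20 * E + 1740000 * c * E"
  proof (cases "X1 \<le> X2 ^ d2")
    case False
    then have "real (X2 ^ d2) \<le> real X1"
      by (simp only: of_nat_le_iff)
    \<comment> \<open>In this range \<open>R\<close> is at least \<open>X2 ^ 2\<close>, the order of
      the trivial bound.\<close>
    then have "(real X2 ^ d2) powr (2 / real d2) \<le> R"
      unfolding R_def by (intro powr_mono2) auto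
    also have "(real X2 ^ d2) powr (2 / real d2) = real X2 ^ 2"
    proof -
      have "real X2 ^ d2 = real X2 powr real d2"
        using X by (simp add: powr_realpow)
      then show ?thesis
        using X d by (simp add: powr_powr)
    qed
    finally have "real d1 * (real X2 ^ 2) \<le> 4 * E"
      using base[of "real d1" 1 "real X2 ^ 2"] pow by simp
    moreover have "real (card S) \<le> real (d1 * (3 * X2\<^sup>2))"
      using card_S_le_trivial by (simp only: of_nat_le_iff)
    moreover have "c * E \<ge> 0"
      using c(1) E by simp
    ultimately show ?thesis
      using E by simp
  next
    case True
    show ?thesis
    proof (cases "card ((\<lambda>P. slope (fst P)) ` S) > 5 * d1 * d2")
      case False
      have "card S \<le> d2 * card ((\<lambda>P. slope (fst P)) ` S)"
        using finite_S by (intro card_points_le[OF irr degF d bideg_rat top S_D]) auto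
      also have "\<dots> \<le> d2 * (5 * d1 * d2)"
        using False by (intro mult_left_mono) auto
      finally have "real (card S) \<le> real (d2 * (5 * d1 * d2))"
        by (simp only: of_nat_le_iff)
      then have "real (card S) \<le> 5 * real d1 * real d2 ^ 2"
        by (simp add: power2_eq_square mult_ac)
      moreover have "c * E \<ge> 0"
        using c(1) E by simp
      ultimately show ?thesis
        using small by simp
    next
      case many: True
      define L where "L = 300 * real d1 * real d2 * ln (real X2)"
      have "L \<ge> 300 * 1 * 1 * (1 / 2)"
        unfolding L_def using d' lnX2 by (intro mult_mono) auto
      then obtain n :: nat where n: "real n \<le> c * L" "2 * L \<le> (\<Sum>p | prime p \<and> p \<le> n. ln (real p))"
        using c(2)[of L] by auto
      have "real (card S) \<le> 5 * real d1 * real d2 ^ 2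
          + 5800 * real n * (real d1 * real d2 ^ 3 * R * ln (real X2))"
        using card_S_le_of_prime[OF many True, of n] n(2) by (simp add: L_def R_def)
      also have "5800 * real n * (real d1 * real d2 ^ 3 * R * ln (real X2))
          \<le> 5800 * (c * L) * (real d1 * real d2 ^ 3 * R * ln (real X2))"
        using n(1) lnX2 R by (intro mult_mono) auto
      also have "\<dots> = 1740000 * c * E"
        by (simp add: L_def E_def power2_eq_square power_numeral_reduce algebra_simps)
      finally show ?thesis
        using small by simp
    qed
  qed
  then show ?thesis
    by (simp add: E_def R_def algebra_simps)
qed

end

section \<open>Counting projective points\<close>

lemma poly_map_poly_hom_add:
  assumes "h 0 = 0" "\<And>x y. h (x + y) = h x + h y"
  shows "poly (map_poly h (p + q)) x = poly (map_poly h p) x + poly (map_poly h q) x"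
  by (simp add: map_poly_hom_add[OF assms])

lemma eval4_add: "eval4 (p + q) x1 x2 y1 y2 = eval4 p x1 x2 y1 y2 + eval4 q x1 x2 y1 y2"
  for p :: "'a::comm_ring_1 mpoly4"
  unfolding eval4_def by (intro poly_map_poly_hom_add) simp_all

lemma eval4_sum: "eval4 (sum f A) x1 x2 y1 y2 = (\<Sum>i\<in>A. eval4 (f i) x1 x2 y1 y2)"
  for f :: "'b \<Rightarrow> 'a::comm_ring_1 mpoly4"
  by (induction A rule: infinite_finite_induct) (simp_all add: eval4_add, simp_all add: eval4_def)

lemma eval4_monom:
  "eval4 (monom (monom (monom (monom c i) j) k) l) x1 x2 y1 y2 = c * x1 ^ i * x2 ^ j * y1 ^ k * y2 ^ l"
  for c :: "'a::comm_ring_1"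
  by (simp add: eval4_def map_poly_monom poly_monom)

lemma eval4_hom4: "eval4 (hom4 a1 a2 A) x1 x2 y1 y2 = biev a1 a2 A x1 x2 y1 y2"
  by (simp add: hom4_altdef eval4_sum eval4_monom biev_def mult_ac)

lemma coeff4_to_rat4: "coeff4 (to_rat4 f) i j k l = of_int (coeff4 f i j k l)"
  by (simp add: coeff4_def to_rat4_def coeff_map_poly)

lemma bihomogeneous_to_rat4: "bihomogeneous f d1 d2 \<Longrightarrow> bihomogeneous (to_rat4 f) d1 d2"
  by (simp add: bihomogeneous_def coeff4_to_rat4)

lemma dehom_to_rat4: "dehom d1 d2 (to_rat4 f) = rat2 (dehom d1 d2 f)"
  by (intro poly_eqI) (simp add: coeff_dehom coeff_rat2 coeff4_to_rat4)

text \<open>For the points with one coordinate at infinity: the remaining condition is a binary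
  form, whose affine zeros have distinct slopes that are roots of \<open>p\<close>.\<close>

lemma card_affine_roots_le:
  fixes p :: "int poly"
  assumes "p \<noteq> 0" "degree p \<le> e"
  shows "finite {x. affine x \<and> hpoly e p (fst x) (snd x) = 0}"
    and "card {x. affine x \<and> hpoly e p (fst x) (snd x) = 0} \<le> e"
proof -
  let ?A = "{x. affine x \<and> hpoly e p (fst x) (snd x) = 0}" and ?p = "map_poly rat_of_int p"
  have p: "?p \<noteq> 0" "degree ?p \<le> e"
    using assms map_poly_degree_leq[of rat_of_int p] by (auto simp: poly_eq_iff coeff_map_poly)
  have "poly ?p (slope x) = 0" if "x \<in> ?A" for x
  proof -
    have pos: "fst x > 0"
      using that by (simp add: affine_def)
    have "0 = rat_of_int (hpoly e p (fst x) (snd x))"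
      using that by simp
    also have "\<dots> = hpoly e ?p (of_int (fst x)) (slope x * of_int (fst x))"
      using pos by (simp add: hpoly_def coeff_map_poly slope_def)
    also have "\<dots> = of_int (fst x) ^ e * poly ?p (slope x)"
      using p(2) by (rule hpoly_scale)
    finally show ?thesis
      using pos by simp
  qed
  then have sub: "slope ` ?A \<subseteq> {t. poly ?p t = 0}"
    by auto
  have inj: "inj_on slope ?A"
    using slope_inj by (rule inj_on_subset) auto
  show "finite ?A"
    using sub inj poly_roots_finite[OF p(1)] by (meson finite_imageD finite_subset)
  have "card ?A = card (slope ` ?A)"
    using inj by (simp add: card_image)
  also have "\<dots> \<le> card {t. poly ?p t = 0}"
    using poly_roots_finite[OF p(1)] sub by (rule card_mono)
  also have "\<dots> \<le> e"
    using card_poly_roots_bound[OF p(1)] p(2) by simp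
  finally show "card ?A \<le> e" .
qed

lemma P1_rep_cases: "P1_rep x \<Longrightarrow> affine x \<or> x = (0, 1)"
  by (cases x) (auto simp: P1_rep_def affine_def)

theorem theorem3p3:
  "\<exists>C::real. \<forall>(f::int mpoly4) (d1::nat) (d2::nat) (B1::real) (B2::real).
     bihomogeneous f d1 d2 \<and> d1 \<ge> 1 \<and> d2 \<ge> 1 \<and> irreducible (to_rat4 f) \<and>
     B1 \<ge> 1 \<and> B2 \<ge> 2 \<longrightarrow>
     real (N_P1P1 f B1 B2) \<le> C * real d1 ^ 7 * real d2 ^ 4 * B1 powr (2 / real d2) * (ln B2) ^ 2"
proof -
  obtain c :: real where c: "c > 0"
    "\<And>L. L \<ge> 1 \<Longrightarrow> \<exists>n::nat. real n \<le> c * L \<and> 2 * L \<le> (\<Sum>p | prime p \<and> p \<le> n. ln (real p))"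
    using ex_primes_sum_ln_ge by blast
  show ?thesis
  proof (intro exI[of _ "32 + 1740000 * c"] allI impI, elim conjE)
    fix f :: "int mpoly4" and d1 d2 :: nat and B1 B2 :: real
    assume bihom: "bihomogeneous f d1 d2" and d: "d1 \<ge> 1" "d2 \<ge> 1" and irr: "irreducible (to_rat4 f)"
      and B: "B1 \<ge> 1" "B2 \<ge> 2"
    define F where "F = dehom d1 d2 f"
    note rat = bihomogeneous_to_rat4[OF bihom]
    have irrF: "irreducible (rat2 F)" and degF: "degree (rat2 F) = d2"
      and topF: "\<exists>l. coeff (coeff (rat2 F) l) d1 \<noteq> 0"
      using irreducible_dehom[OF rat d irr] degree_dehom[OF rat d irr] ex_coeff_dehom[OF rat d irr]
      unfolding dehom_to_rat4 F_def by blast+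
    have bidegF: "bideg_le d1 d2 F"
      by (simp add: F_def bideg_le_dehom)
    have eval: "eval4 f x1 x2 y1 y2 = biev d1 d2 F x1 x2 y1 y2" for x1 x2 y1 y2
      using eval4_hom4[of d1 d2 F x1 x2 y1 y2] hom4_dehom[OF bihom] by (simp add: F_def)
    \<comment> \<open>Heights are integers, so replacing the bounds by their floors keeps the same
      points.\<close>
    define X1 where "X1 = nat \<lfloor>B1\<rfloor>"
    define X2 where "X2 = nat \<lfloor>B2\<rfloor>"
    have X: "X1 \<ge> 1" "X2 \<ge> 2" "real X1 \<le> B1" "real X2 \<le> B2"
      using B unfolding X1_def X2_def by linarith+
    have ht: "h \<le> int X1" if "real_of_int h \<le> B1" for h
      using that B unfolding X1_def by linarith
    have ht': "h \<le> int X2" if "real_of_int h \<le> B2" for h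
      using that B unfolding X2_def by linarith
    define S where "S = {P. affine (fst P) \<and> affine (snd P) \<and> ev2 (rat2 F) (slope (fst P)) (slope (snd P)) = 0 \<and>
      height1 (fst P) \<le> int X1 \<and> height1 (snd P) \<le> int X2}"
    \<comment> \<open>The top coefficients in \<open>t\<close> and in \<open>u\<close> give the
      restrictions of the form to \<open>x = (0, 1)\<close> and to
      \<open>y = (0, 1)\<close>.\<close>
    define px where "px = map_poly (\<lambda>c. coeff c d1) F"
    define py where "py = coeff F d2"
    define Sx where "Sx = {y. affine y \<and> hpoly d2 px (fst y) (snd y) = 0}"
    define Sy where "Sy = {x. affine x \<and> hpoly d1 py (fst x) (snd x) = 0}"
    have px: "px \<noteq> 0" "degree px \<le> d2"
    proof -
      show "px \<noteq> 0"
        using topF by (auto simp: px_def poly_eq_iff coeff_map_poly)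
      show "degree px \<le> d2"
        unfolding px_def using map_poly_degree_leq[of "\<lambda>c. coeff c d1" F] bidegF by (simp add: bideg_le_def)
    qed
    have py: "py \<noteq> 0" "degree py \<le> d1"
    proof -
      have "coeff (rat2 F) d2 \<noteq> 0"
        using degF d by (metis degree_0 leading_coeff_0_iff not_one_le_zero)
      then show "py \<noteq> 0"
        by (auto simp: py_def coeff_map_poly)
      show "degree py \<le> d1"
        using bidegF by (simp add: py_def bideg_le_def)
    qed
    have ev_x: "biev d1 d2 F 0 1 y1 y2 = hpoly d2 px y1 y2" for y1 y2
      by (simp add: biev_nested hpoly_0_1 coeff_hpoly_const)
         (simp add: hpoly_def px_def coeff_map_poly mult.assoc)
    have ev_y: "biev d1 d2 F x1 x2 0 1 = hpoly d1 py x1 x2" for x1 x2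
      using hpoly_0_1[of d2 F] by (simp add: biev_nested py_def one_pCons)
    let ?Z = "{(x, y). P1_rep x \<and> P1_rep y \<and> eval4 f (fst x) (snd x) (fst y) (snd y) = 0 \<and>
      real_of_int (height1 x) \<le> B1 \<and> real_of_int (height1 y) \<le> B2}"
    have sub: "?Z \<subseteq> S \<union> (Pair (0, 1) ` Sx \<union> ((\<lambda>x. (x, (0, 1))) ` Sy \<union> {((0, 1), (0, 1))}))"
    proof (rule subsetI)
      fix P assume "P \<in> ?Z"
      then obtain x y where P: "P = (x, y)" "P1_rep x" "P1_rep y"
        and zero: "biev d1 d2 F (fst x) (snd x) (fst y) (snd y) = 0"
        and h: "real_of_int (height1 x) \<le> B1" "real_of_int (height1 y) \<le> B2"
        by (auto simp: eval)
      consider "affine x" "affine y" | "x = (0, 1)" "affine y" | "affine x" "y = (0, 1)" | "x = (0, 1)" "y = (0, 1)"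
        using P1_rep_cases[OF P(2)] P1_rep_cases[OF P(3)] by blast
      then show "P \<in> S \<union> (Pair (0, 1) ` Sx \<union> ((\<lambda>x. (x, (0, 1))) ` Sy \<union> {((0, 1), (0, 1))}))"
      proof cases
        case 1
        then have "ev2 (rat2 F) (slope x) (slope y) = 0"
          using bev_eq_0_iff[OF bidegF, of P] zero by (simp add: P(1) bev_def)
        then show ?thesis
          using 1 ht[OF h(1)] ht'[OF h(2)] by (simp add: S_def P(1))
      next
        case 2
        then show ?thesis
          using zero by (auto simp: P(1) Sx_def ev_x)
      next
        case 3
        then show ?thesis
          using zero by (auto simp: P(1) Sy_def ev_y)
      qed (simp add: P(1))
    qed
    have fin: "finite S" "finite Sx" "finite Sy"
      using finite_S[OF irrF degF d bidegF topF X(1,2)] card_affine_roots_le(1)[OF px] card_affine_roots_le(1)[OF py]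
      by (simp_all add: S_def Sx_def Sy_def)
    have "N_P1P1 f B1 B2 \<le> card (S \<union> (Pair (0, 1) ` Sx \<union> ((\<lambda>x. (x, (0, 1))) ` Sy \<union> {((0, 1), (0, 1))})))"
      unfolding N_P1P1_def using fin by (intro card_mono sub) auto
    also have "\<dots> \<le> card S + (card (Pair (0 :: int, 1 :: int) ` Sx) + (card ((\<lambda>x. (x, (0 :: int, 1 :: int))) ` Sy) + 1))"
      by (intro order_trans[OF card_Un_le] add_mono order.refl) simp
    also have "\<dots> \<le> card S + (d2 + (d1 + 1))"
      using card_image_le[OF fin(2), of "Pair (0 :: int, 1 :: int)"] card_image_le[OF fin(3), of "\<lambda>x. (x, (0 :: int, 1 :: int))"]
        card_affine_roots_le(2)[OF px] card_affine_roots_le(2)[OF py]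
      by (simp add: Sx_def Sy_def)
    finally have "real (N_P1P1 f B1 B2) \<le> real (card S + (d2 + (d1 + 1)))"
      by (simp only: of_nat_le_iff)
    then have N: "real (N_P1P1 f B1 B2) \<le> real (card S) + (real d2 + (real d1 + 1))"
      by simp
    define E where "E = real d1 ^ 7 * real d2 ^ 4 * (B1 powr (2 / real d2) * ln B2 ^ 2)"
    have d': "real d1 \<ge> 1" "real d2 \<ge> 1"
      using d by auto
    have lnB2: "ln B2 \<ge> 1 / 2"
      using B by (intro ln_ge_half)
    have "real (card S) \<le> (20 + 1740000 * c) * (real d1 ^ 2 * real d2 ^ 4 * real X1 powr (2 / real d2) * ln (real X2) ^ 2)"
      unfolding S_def by (rule card_S_le[OF irrF degF d bidegF topF X(1,2) c])
    also have "\<dots> \<le> (20 + 1740000 * c) * E"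
      unfolding E_def mult.assoc[of "_ * _ ^ 4"]
    proof (intro mult_left_mono mult_mono power_mono powr_mono2)
      show "real d1 ^ 2 \<le> real d1 ^ 7"
        using d' by (intro power_increasing) auto
    qed (use X B c(1) in auto)
    finally have S: "real (card S) \<le> (20 + 1740000 * c) * E" .
    \<comment> \<open>The points at infinity are absorbed into \<open>E\<close>: each of the three
      summands is at most \<open>4 * E\<close>, because \<open>ln B2 >= 1 / 2\<close>. Together with
      20 this gives the constant 32.\<close>
    have "real d2 + (real d1 + 1) \<le> 12 * E"
    proof -
      have "real d1 * 1 \<le> real d1 ^ 7 * real d2 ^ 4" "1 * real d2 \<le> real d1 ^ 7 * real d2 ^ 4"
        "1 * 1 \<le> real d1 ^ 7 * real d2 ^ 4"
        using d' by (intro mult_mono self_le_power one_le_power; simp)+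
      then have "real d2 + (real d1 + 1) \<le> 3 * (real d1 ^ 7 * real d2 ^ 4)"
        by linarith
      also have "\<dots> \<le> 3 * (real d1 ^ 7 * real d2 ^ 4 * (4 * (B1 powr (2 / real d2) * ln B2 ^ 2)))"
      proof -
        have "(1 / 2) ^ 2 \<le> ln B2 ^ 2"
          using lnB2 by (intro power_mono) auto
        then have "1 * (1 / 4) \<le> B1 powr (2 / real d2) * ln B2 ^ 2"
          using B by (intro mult_mono ge_one_powr_ge_zero) (auto simp: power_divide)
        then have "1 \<le> 4 * (B1 powr (2 / real d2) * ln B2 ^ 2)"
          by simp
        then have "real d1 ^ 7 * real d2 ^ 4 * 1 \<le> real d1 ^ 7 * real d2 ^ 4 * (4 * (B1 powr (2 / real d2) * ln B2 ^ 2))"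
          by (rule mult_left_mono) simp
        then show ?thesis
          by linarith
      qed
      finally show ?thesis
        by (simp add: E_def)
    qed
    with N S have "real (N_P1P1 f B1 B2) \<le> (32 + 1740000 * c) * E"
      by (simp add: algebra_simps)
    then show "real (N_P1P1 f B1 B2)
        \<le> (32 + 1740000 * c) * real d1 ^ 7 * real d2 ^ 4 * B1 powr (2 / real d2) * ln B2 ^ 2"
      by (simp add: E_def mult.assoc)
  qed
qed

end
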